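(* Let $d\ge1$, $\lambda=\frac{d-1}2$ and $F\in C[-1,1]$. Then $\sigma$ is the unique minimizer of $I_F(\mu)$ over $\mu\in\mathcal M$ if and only if $\widehat F(n,\lambda)>0$ for each $n\ge1$.
   Context: $\mathbb S^d\subset\mathbb R^{d+1}$ is the unit sphere, $\sigma$ is the normalized surface measure ($\sigma(\mathbb S^d)=1$), $\mathcal M$ is the set of Borel probability measures on $\mathbb S^d$, and $I_F(\mu)=\int_{\mathbb S^d}\int_{\mathbb S^d}F(x\cdot y)\,d\mu(x)\,d\mu(y)$. With $w_\lambda(t)=(1-t^2)^{\lambda-\frac12}$, the Gegenbauer coefficients $\widehat F(n,\lambda)$ are the coefficients of the expansion $F(t)\sim\sum_{n\ge0}\widehat F(n,\lambda)\frac{n+\lambda}\lambda C_n^\lambda(t)$ in Gegenbauer (ultraspherical) polynomials $C_n^\lambda$, i.e. $$\widehat F(n,\lambda)=\Big(\int_{-1}^1w_\lambda(t)\,dt\Big)^{-1}\int_{-1}^1F(t)\frac{C_n^\lambda(t)}{C_n^\lambda(1)}w_\lambda(t)\,dt.$$ For $d=1$ ($\lambda=0$) the quotient $C_n^\lambda(t)/C_n^\lambda(1)$ is interpreted as its limit $\cos(n\arccos t)$. *)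

theory Defs
  imports "HOL-Probability.Probability"
begin

text \<open>
  The surface measure of the unit sphere assigns to a Borel set \<open>A\<close> of unit vectors the number
  \<open>DIM\<close> times the volume of the cone \<open>{r x | 0 < r \<le> 1, x \<in> A}\<close>; the factor is the one
  appearing in the polar coordinate formula \<open>dx = r ^ (DIM - 1) dr d(surface)\<close>.
\<close>

definition sphere_borel :: "'a::euclidean_space measure" where
  "sphere_borel = restrict_space borel (sphere 0 1)"

definition surface_measure :: "'a::euclidean_space measure" where
  "surface_measure = measure_of (sphere 0 1) (sets sphere_borel)
     (\<lambda>A. of_nat DIM('a) * emeasure lborel {r *\<^sub>R x | r x. 0 < r \<and> r \<le> 1 \<and> x \<in> A})"

definition normalized_surface_measure :: "'a::euclidean_space measure" where
  "normalized_surface_measure = uniform_measure surface_measure (sphere 0 1)"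

definition sphere_prob_measures :: "'a::euclidean_space measure set" where
  "sphere_prob_measures = {\<mu>. sets \<mu> = sets sphere_borel \<and> prob_space \<mu>}"

definition energy :: "(real \<Rightarrow> real) \<Rightarrow> 'a::euclidean_space measure \<Rightarrow> real" where
  "energy F \<mu> = (\<integral>y. (\<integral>x. F (x \<bullet> y) \<partial>\<mu>) \<partial>\<mu>)"

text \<open>Gegenbauer polynomials by their three-term recurrence in the degree.\<close>

fun gegenbauer :: "nat \<Rightarrow> real \<Rightarrow> real \<Rightarrow> real" where
  "gegenbauer 0 l t = 1"
| "gegenbauer (Suc 0) l t = 2 * l * t"
| "gegenbauer (Suc (Suc n)) l t =
     (2 * (real n + 1 + l) * t * gegenbauer (Suc n) l t - (real n + 2 * l) * gegenbauer n l t)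
       / (real n + 2)"

text \<open>
  For \<open>l = 0\<close> and \<open>n \<ge> 1\<close> the polynomial \<open>C\<^sub>n\<^sup>l\<close> vanishes identically, so the quotient
  is replaced by its limit as \<open>l\<close> tends to \<open>0\<close>.
\<close>

definition gegenbauer_quotient :: "nat \<Rightarrow> real \<Rightarrow> real \<Rightarrow> real" where
  "gegenbauer_quotient n l t =
     (if l = 0 then cos (real n * arccos t) else gegenbauer n l t / gegenbauer n l 1)"

text \<open>
  \<open>0 powr a = 0\<close> fixes the values at the end points, which do not matter for the integrals.
\<close>

definition gegenbauer_weight :: "real \<Rightarrow> real \<Rightarrow> real" where
  "gegenbauer_weight l t = (1 - t\<^sup>2) powr (l - 1/2)"

definition gegenbauer_coeff :: "(real \<Rightarrow> real) \<Rightarrow> nat \<Rightarrow> real \<Rightarrow> real" where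
  "gegenbauer_coeff F n l =
     inverse (LBINT t:{-1..1}. gegenbauer_weight l t) *
     (LBINT t:{-1..1}. F t * gegenbauer_quotient n l t * gegenbauer_weight l t)"

lemma sets_surface_measure: "sets surface_measure = sets (sphere_borel :: 'a::euclidean_space measure)"
proof -
  have "space (sphere_borel :: 'a measure) = sphere 0 1"
    by (simp add: sphere_borel_def space_restrict_space)
  then show ?thesis
    unfolding surface_measure_def using sets.sets_measure_of_eq[of "sphere_borel :: 'a measure"] by simp
qed

lemma cone_eq:
  assumes "A \<subseteq> sphere (0::'a::euclidean_space) 1"
  shows "{r *\<^sub>R x | r x. 0 < r \<and> r \<le> 1 \<and> x \<in> A} = (cball 0 1 - {0}) \<inter> sgn -` A"
proof (intro set_eqI iffI)
  fix z assume "z \<in> {r *\<^sub>R x | r x. 0 < r \<and> r \<le> 1 \<and> x \<in> A}"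
  then show "z \<in> (cball 0 1 - {0}) \<inter> sgn -` A"
    using assms by (auto simp: sgn_div_norm)
next
  fix z assume z: "z \<in> (cball 0 1 - {0}) \<inter> sgn -` A"
  then have "z = norm z *\<^sub>R sgn z" by (simp add: sgn_div_norm)
  then show "z \<in> {r *\<^sub>R x | r x. 0 < r \<and> r \<le> 1 \<and> x \<in> A}"
    using z by (auto intro!: exI[of _ "norm z"] exI[of _ "sgn z"])
qed

lemma emeasure_surface_measure:
  assumes "A \<in> sets (sphere_borel :: 'a::euclidean_space measure)"
  shows "emeasure surface_measure A =
    of_nat DIM('a) * emeasure lborel {r *\<^sub>R x | r x. 0 < r \<and> r \<le> 1 \<and> x \<in> A}"
proof -
  have sub: "A \<subseteq> sphere 0 1" "A \<in> sets borel" if "A \<in> sets (sphere_borel :: 'a measure)" for A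
    using that by (auto simp: sphere_borel_def sets_restrict_space)
  have sgn[measurable]: "(sgn :: 'a \<Rightarrow> 'a) \<in> borel_measurable borel"
    unfolding sgn_div_norm by measurable
  have meas: "(cball 0 1 - {0}) \<inter> sgn -` A \<in> sets borel" if "A \<in> sets (sphere_borel :: 'a measure)" for A
    using measurable_sets_borel[OF sgn sub(2)[OF that]] by auto
  show ?thesis
  proof (rule emeasure_measure_of[OF surface_measure_def])
    show "sets sphere_borel \<subseteq> Pow (sphere (0::'a) 1)" using sub by auto
    show "A \<in> sets surface_measure" using assms by (simp add: sets_surface_measure)
    show "positive (sets surface_measure)
     (\<lambda>A. of_nat DIM('a) * emeasure lborel {r *\<^sub>R x |r x::'a. 0 < r \<and> r \<le> 1 \<and> x \<in> A})"
      by (simp add: positive_def)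
    show "countably_additive (sets surface_measure)
     (\<lambda>A. of_nat DIM('a) * emeasure lborel {r *\<^sub>R x |r x::'a. 0 < r \<and> r \<le> 1 \<and> x \<in> A})"
    proof (rule countably_additiveI)
      fix B :: "nat \<Rightarrow> 'a set"
      assume B: "range B \<subseteq> sets surface_measure" "disjoint_family B" "\<Union> (range B) \<in> sets surface_measure"
      then have Bi: "B i \<in> sets sphere_borel" for i by (auto simp: sets_surface_measure)
      have U: "\<Union> (range B) \<subseteq> sphere 0 1" using sub(1)[OF Bi] by blast
      let ?C = "\<lambda>A. (cball (0::'a) 1 - {0}) \<inter> sgn -` A"
      have "(\<Sum>i. emeasure lborel (?C (B i))) = emeasure lborel (\<Union>i. ?C (B i))"
        using B(2) meas[OF Bi] by (intro suminf_emeasure) (auto simp: disjoint_family_on_def)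
      also have "(\<Union>i. ?C (B i)) = ?C (\<Union> (range B))" by auto
      finally show "(\<Sum>i. of_nat DIM('a) * emeasure lborel {r *\<^sub>R x |r x::'a. 0 < r \<and> r \<le> 1 \<and> x \<in> B i})
        = of_nat DIM('a) * emeasure lborel {r *\<^sub>R x |r x::'a. 0 < r \<and> r \<le> 1 \<and> x \<in> \<Union> (range B)}"
        unfolding cone_eq[OF sub(1)[OF Bi]] cone_eq[OF U] by (simp only: ennreal_suminf_cmult)
    qed
  qed
qed

lemma normalized_surface_measure_in_sphere_prob_measures:
  "normalized_surface_measure \<in> (sphere_prob_measures :: 'a::euclidean_space measure set)"
proof -
  have s: "sphere 0 1 \<in> sets (sphere_borel :: 'a measure)"
    by (auto simp: sphere_borel_def sets_restrict_space)
  have sg: "norm (sgn x) = 1" if "x \<noteq> 0" for x :: 'a using that by (simp add: norm_sgn)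
  have "emeasure surface_measure (sphere (0::'a) 1) = of_nat DIM('a) * emeasure lborel (cball (0::'a) 1 - {0})"
    unfolding emeasure_surface_measure[OF s] cone_eq[OF order_refl]
    by (rule arg_cong[where f = "\<lambda>X. of_nat DIM('a) * emeasure lborel X"]) (auto simp: sg)
  also have "emeasure lborel (cball (0::'a) 1 - {0}) = emeasure lborel (cball (0::'a) 1)"
    by (subst emeasure_Diff) auto
  finally have e: "emeasure surface_measure (sphere (0::'a) 1) =
    of_nat DIM('a) * emeasure lborel (cball (0::'a) 1)" .
  have "emeasure surface_measure (sphere (0::'a) 1) \<noteq> 0"
    using content_cball_pos[of 1 "0::'a"] DIM_positive[where 'a='a] unfolding e
    by (auto simp: measure_def)
  moreover have "emeasure surface_measure (sphere (0::'a) 1) \<noteq> \<infinity>"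
    unfolding e using emeasure_lborel_cball_finite[of "0::'a" 1]
    by (auto simp: ennreal_mult_eq_top_iff)
  ultimately show ?thesis
    unfolding sphere_prob_measures_def normalized_surface_measure_def
    by (auto intro!: prob_space_uniform_measure simp: sets_surface_measure)
qed

end

theory Submission
  imports Defs
begin

text \<open>
  Write \<open>P\<^sub>n = C\<^sub>n\<^sup>l / C\<^sub>n\<^sup>l(1)\<close>. Convolution with a zonal kernel is self-adjoint and does not raise
  the degree of zonal polynomials, so it maps \<open>P\<^sub>n\<close> to a multiple of itself (Funk-Hecke), the factor
  being the \<open>n\<close>-th Gegenbauer coefficient of the kernel. In particular \<open>P\<^sub>n\<close> is a positive multiple of its
  self-convolution, so its energy is a mean square. Smoothing a kernel \<open>F\<close> on both sides by a polynomial
  approximate identity gives a finite combination of the \<open>P\<^sub>n\<close> whose coefficients have the same signs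
  as those of \<open>F\<close>; hence a continuous kernel with nonnegative coefficients has nonnegative energy. Applied
  to \<open>F\<close> minus its mean and minus one term of its expansion this bounds \<open>I\<^sub>F(\<mu>) - I\<^sub>F(\<sigma>)\<close> from
  below by a positive multiple of the energy of \<open>P\<^sub>n\<close>, for every \<open>n \<ge> 1\<close>; if these energies all
  vanish, \<open>\<mu>\<close> and \<open>\<sigma>\<close> agree on the approximate identity and therefore coincide. Conversely, the
  perturbation \<open>(1 + \<epsilon> P\<^sub>n) \<sigma>\<close> changes the energy of \<open>\<sigma>\<close> by a positive multiple of the \<open>n\<close>-th
  coefficient.
\<close>

subsection \<open>Borel probability measures on the sphere\<close>

text \<open>Sphere and interval are linked through moments. The surface measure, a cone volume,
  enters through its invariance under reflections. Invariance yields the recurrence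
  \<open>mean_moment_rec\<close>, partial integration yields the same recurrence for the weight, and
  together with the values at degrees 0 and 1 it determines every moment. The locale
  \<open>gegenbauer_functional\<close> derives orthogonality from this recurrence alone, so it
  serves both functionals. Normalising by P_n(1) = 1 treats the circle (l = 0) together with the
  higher spheres and lets eigenvalues be read off at a pole. The obstacle to sufficiency is that the
  Gegenbauer series of a continuous F need not converge uniformly. Smoothing on both sides instead
  of one is what puts squares (a m)^2 into the coefficients: those of the peak kernel itself have no
  sign that is known. Errors are measured by eps + C (1 - x . y), because the mean of q(t) (1 - t)
  is exactly what partial integration controls for a power of 1 + t.\<close>

lemma
  assumes "\<mu> \<in> (sphere_prob_measures :: 'a::euclidean_space measure set)"
  shows space_sphere_prob: "space \<mu> = sphere 0 1"
    and sets_sphere_prob: "sets \<mu> = sets sphere_borel"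
    and prob_space_sphere_prob: "prob_space \<mu>"
    and measurable_ident_sphere_prob: "(\<lambda>x. x) \<in> borel_measurable \<mu>"
proof -
  show s: "sets \<mu> = sets sphere_borel" and "prob_space \<mu>"
    using assms by (auto simp: sphere_prob_measures_def)
  show "space \<mu> = sphere 0 1"
    using sets_eq_imp_space_eq[OF s] by (simp add: sphere_borel_def space_restrict_space)
  show "(\<lambda>x. x) \<in> borel_measurable \<mu>"
    unfolding measurable_cong_sets[OF s refl] sphere_borel_def
    by (intro measurable_restrict_space1) simp
qed

lemma measurable_sphere_prob:
  assumes "\<mu> \<in> sphere_prob_measures" "f \<in> measurable borel M"
  shows "f \<in> measurable \<mu> M"
  using measurable_compose[OF measurable_ident_sphere_prob[OF assms(1)] assms(2)] by simp

lemma integrable_sphere_prob: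
  fixes f :: "'a::euclidean_space \<Rightarrow> real"
  assumes \<mu>: "\<mu> \<in> sphere_prob_measures" and f: "f \<in> borel_measurable \<mu>"
    and B: "\<And>x. norm x = 1 \<Longrightarrow> \<bar>f x\<bar> \<le> B"
  shows "integrable \<mu> f"
proof -
  interpret prob_space \<mu> by (rule prob_space_sphere_prob[OF \<mu>])
  show ?thesis
    using f B by (intro integrable_const_bound[where B = B])
      (auto simp: space_sphere_prob[OF \<mu>] intro!: AE_I2)
qed

lemma sphere_prob_measures_pair:
  assumes "\<mu> \<in> sphere_prob_measures" "\<nu> \<in> sphere_prob_measures"
  shows "pair_prob_space \<mu> \<nu>"
  using assms by (auto simp: pair_prob_space_def pair_sigma_finite_def prob_space_sphere_prob
      intro!: prob_space_imp_sigma_finite)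

lemma integral_swap_sphere_prob:
  fixes f :: "'a::euclidean_space \<Rightarrow> 'a \<Rightarrow> real"
  assumes \<mu>: "\<mu> \<in> sphere_prob_measures" and \<nu>: "\<nu> \<in> sphere_prob_measures"
    and f: "(\<lambda>(x, y). f x y) \<in> borel_measurable (\<mu> \<Otimes>\<^sub>M \<nu>)"
    and B: "\<And>x y. norm x = 1 \<Longrightarrow> norm y = 1 \<Longrightarrow> \<bar>f x y\<bar> \<le> B"
  shows "(\<integral>y. (\<integral>x. f x y \<partial>\<mu>) \<partial>\<nu>) = (\<integral>x. (\<integral>y. f x y \<partial>\<nu>) \<partial>\<mu>)"
proof -
  interpret pair_prob_space \<mu> \<nu> by (rule sphere_prob_measures_pair[OF \<mu> \<nu>])
  show ?thesis
    using B by (intro Fubini_integral P.integrable_const_bound[where B = B] f AE_I2)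
      (auto simp: space_pair_measure space_sphere_prob[OF \<mu>] space_sphere_prob[OF \<nu>])
qed

lemma abs_integral_sphere_prob_le:
  fixes f :: "'a::euclidean_space \<Rightarrow> real"
  assumes \<mu>: "\<mu> \<in> sphere_prob_measures" 
    and B: "\<And>x. norm x = 1 \<Longrightarrow> \<bar>f x\<bar> \<le> B"
  shows "\<bar>\<integral>x. f x \<partial>\<mu>\<bar> \<le> B"
proof -
  interpret prob_space \<mu> by (rule prob_space_sphere_prob[OF \<mu>])
  \<comment> \<open>Some unit vector exists, so \<open>B\<close> is nonnegative. This settles the
    non-integrable case, where the integral is 0 by convention.\<close>
  obtain x :: 'a where "norm x = 1" using vector_choose_size[of 1] by auto
  then have B0: "0 \<le> B" using B[of x] by linarith
  show ?thesis
  proof (cases "integrable \<mu> f")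
    case True
    then have "\<bar>\<integral>x. f x \<partial>\<mu>\<bar> \<le> (\<integral>x. \<bar>f x\<bar> \<partial>\<mu>)" by (simp add: integral_abs_bound)
    also have "\<dots> \<le> (\<integral>x. B \<partial>\<mu>)"
      using True B by (intro integral_mono) (auto simp: space_sphere_prob[OF \<mu>])
    finally show ?thesis by (simp add: prob_space)
  qed (simp add: not_integrable_integral_eq B0)
qed

lemma integral_cong_sphere_prob:
  fixes f :: "'a::euclidean_space \<Rightarrow> real"
  assumes "\<mu> \<in> sphere_prob_measures" "\<And>x. norm x = 1 \<Longrightarrow> f x = g x"
  shows "(\<integral>x. f x \<partial>\<mu>) = (\<integral>x. g x \<partial>\<mu>)"
  using assms by (intro Bochner_Integration.integral_cong) (auto simp: space_sphere_prob)

subsection \<open>Reflection invariance of the surface measure\<close>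

text \<open>The reflection in the hyperplane orthogonal to \<open>v\<close>. It is the identity for
  \<open>v = 0\<close>, so \<open>reflect (a - b)\<close> stays meaningful when
  \<open>a = b\<close>.\<close>

definition reflect :: "'a::euclidean_space \<Rightarrow> 'a \<Rightarrow> 'a" where
  "reflect v x = x - (2 * (v \<bullet> x) / (v \<bullet> v)) *\<^sub>R v"

lemma inner_reflect_reflect: "reflect v x \<bullet> reflect v y = x \<bullet> y"
  by (cases "v = 0") (simp_all add: reflect_def inner_diff_left inner_diff_right inner_commute field_simps)

lemma norm_reflect [simp]: "norm (reflect v x) = norm x"
  by (simp add: norm_eq_sqrt_inner inner_reflect_reflect)

lemma reflect_eq_0_iff [simp]: "reflect v x = 0 \<longleftrightarrow> x = 0"
  using norm_reflect[of v x] by (metis norm_eq_zero)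

lemma reflect_reflect [simp]: "reflect v (reflect v x) = x"
  by (cases "v = 0") (simp_all add: reflect_def inner_diff_right)

lemma linear_reflect: "linear (reflect v)"
  unfolding reflect_def by (rule linearI) (simp_all add: inner_add_right algebra_simps add_divide_distrib)

lemma inner_reflect_left: "reflect v x \<bullet> y = x \<bullet> reflect v y"
  by (metis inner_reflect_reflect reflect_reflect)

lemma reflect_eq_self: "v \<bullet> x = 0 \<Longrightarrow> reflect v x = x"
  by (simp add: reflect_def)

lemma reflect_self: "reflect v v = - v"
  by (cases "v = 0") (simp_all add: reflect_def scaleR_2)

text \<open>Equal norms give |a - b|^2 = 2 (a - b) . a, so the coefficient of \<open>a - b\<close>
  is 1. Hence reflections act transitively on the sphere.\<close>

lemma reflect_diff:
  assumes "norm a = norm b"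
  shows "reflect (a - b) a = b"
proof (cases "a = b")
  case False
  have "(a - b) \<bullet> (a - b) = 2 * ((a - b) \<bullet> a)"
    using assms by (simp add: norm_eq inner_diff_left inner_diff_right inner_commute)
  moreover have "(a - b) \<bullet> (a - b) \<noteq> 0" using False by simp
  ultimately show ?thesis by (simp add: reflect_def)
qed (simp add: reflect_def)

lemma measurable_reflect [measurable]: "reflect v \<in> borel_measurable borel"
  by (intro borel_measurable_continuous_onI linear_continuous_on linear_conv_bounded_linear[THEN iffD1] linear_reflect)

text \<open>Haar uniqueness in the only case needed: test both measures against the unit ball,
  which the isometry preserves.\<close>

lemma nn_integral_lborel_reflect:
  fixes v :: "'a::euclidean_space" and f :: "'a \<Rightarrow> ennreal"
  assumes [measurable]: "f \<in> borel_measurable borel"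
  shows "(\<integral>\<^sup>+x. f (reflect v x) \<partial>lborel) = (\<integral>\<^sup>+x. f x \<partial>lborel)"
proof -
  let ?T = "reflect v"
  define g :: "'a \<Rightarrow> ennreal" where "g = indicator (ball 0 1)"
  let ?V = "emeasure lborel (ball (0::'a) 1)"
  have [measurable]: "g \<in> borel_measurable borel"
    unfolding g_def by (intro borel_measurable_indicator) auto
  have g_int: "(\<integral>\<^sup>+x. g x \<partial>lborel) = ?V"
    unfolding g_def by simp
  have shift: "(\<integral>\<^sup>+x. h (c + x) \<partial>lborel) = (\<integral>\<^sup>+x. h x \<partial>lborel)"
    if [measurable]: "h \<in> borel_measurable borel" for h :: "'a \<Rightarrow> ennreal" and c
    by (subst (2) lborel_distr_plus[of c, symmetric]) (simp add: nn_integral_distr)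
  have shift': "(\<integral>\<^sup>+x. h (?T x + y) \<partial>lborel) = (\<integral>\<^sup>+x. h (?T x) \<partial>lborel)"
    if [measurable]: "h \<in> borel_measurable borel" for h :: "'a \<Rightarrow> ennreal" and y
    using shift[of "\<lambda>x. h (?T x)" "?T y"] by (simp add: linear_add[OF linear_reflect] add.commute)
  \<comment> \<open>\<open>?T\<close> is an isometric involution, so |y - T x| = |x - T y| and the
    points \<open>x\<close> that count form a translated ball.\<close>
  have ball: "(\<integral>\<^sup>+x. g (y - ?T x) \<partial>lborel) = ?V" for y
  proof -
    have "norm (y - ?T x) = norm (x + - ?T y)" for x
      using norm_reflect[of v "y - ?T x"] by (simp add: linear_diff[OF linear_reflect] norm_minus_commute)
    then have "(\<integral>\<^sup>+x. g (y - ?T x) \<partial>lborel) = (\<integral>\<^sup>+x. g (- ?T y + x) \<partial>lborel)"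
      by (intro nn_integral_cong) (auto simp: g_def indicator_def add.commute)
    also have "\<dots> = ?V"
      using shift[of g "- ?T y"] by (simp add: g_int)
    finally show ?thesis .
  qed
  have "(\<integral>\<^sup>+x. f (?T x + y) * g y \<partial>lborel) = (\<integral>\<^sup>+x. f (?T x) \<partial>lborel) * g y" for y
    by (subst nn_integral_multc) (auto simp: shift')
  moreover have "(\<integral>\<^sup>+y. c * g y \<partial>lborel) = c * ?V" for c
    by (simp add: nn_integral_cmult g_int)
  \<comment> \<open>The double integral of f(T x + y) g(y) is evaluated twice: in \<open>x\<close>
    first, where the shift by \<open>y\<close> disappears, and after substituting y - T x for
    \<open>y\<close>, where integrating g(y - T x) in \<open>x\<close> gives the volume of the
    ball.\<close>
  ultimately have "(\<integral>\<^sup>+x. f (?T x) \<partial>lborel) * ?V = (\<integral>\<^sup>+y. (\<integral>\<^sup>+x. f (?T x + y) * g y \<partial>lborel) \<partial>lborel)"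
    by (simp only:)
  also have "\<dots> = (\<integral>\<^sup>+x. (\<integral>\<^sup>+y. f (?T x + y) * g y \<partial>lborel) \<partial>lborel)"
    by (rule lborel_pair.Fubini') measurable
  also have "\<dots> = (\<integral>\<^sup>+x. (\<integral>\<^sup>+y. f y * g (y - ?T x) \<partial>lborel) \<partial>lborel)"
    using shift[of "\<lambda>y. f y * g (y - ?T x)" "?T x" for x] by (simp add: borel_measurable_times)
  also have "\<dots> = (\<integral>\<^sup>+y. (\<integral>\<^sup>+x. f y * g (y - ?T x) \<partial>lborel) \<partial>lborel)"
    by (rule lborel_pair.Fubini'[symmetric]) measurable
  also have "\<dots> = (\<integral>\<^sup>+y. f y \<partial>lborel) * ?V"
    by (simp add: nn_integral_cmult ball nn_integral_multc)
  finally have "(\<integral>\<^sup>+x. f (?T x) \<partial>lborel) * ?V = (\<integral>\<^sup>+x. f x \<partial>lborel) * ?V" .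
  moreover have "?V \<noteq> 0" using content_ball_pos[of 1 "0::'a"] by (auto simp: measure_def)
  moreover have "?V \<noteq> \<top>" using emeasure_lborel_ball_finite[of "0::'a" 1] by auto
  ultimately show ?thesis by (simp add: ennreal_mult_cancel_left mult.commute[of _ ?V])
qed

lemma emeasure_lborel_reflect:
  assumes [measurable]: "A \<in> sets borel"
  shows "emeasure lborel (reflect v -` A) = emeasure lborel A"
proof -
  have [measurable]: "reflect v -` A \<in> sets borel"
    using measurable_sets_borel[OF measurable_reflect assms] by simp
  have "emeasure lborel (reflect v -` A) = (\<integral>\<^sup>+x. indicator A (reflect v x) \<partial>lborel)"
    by (simp flip: nn_integral_indicator add: indicator_vimage)
  also have "\<dots> = emeasure lborel A"
    by (simp add: nn_integral_lborel_reflect)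
  finally show ?thesis .
qed

abbreviation \<sigma> :: "'a::euclidean_space measure" where
  "\<sigma> \<equiv> normalized_surface_measure"

lemmas sigma_in = normalized_surface_measure_in_sphere_prob_measures

text \<open>A reflection commutes with \<open>sgn\<close>, so the cone over the preimage of
  \<open>A\<close> is the preimage of the cone over \<open>A\<close>, and the invariance of
  \<open>lborel\<close> carries over.\<close>

lemma emeasure_normalized_surface_measure_reflect:
  fixes A :: "'a::euclidean_space set"
  assumes A: "A \<in> sets sphere_borel"
  shows "emeasure \<sigma> (reflect v -` A \<inter> sphere 0 1) = emeasure \<sigma> A"
proof -
  let ?cone = "\<lambda>A. {r *\<^sub>R x | r x :: 'a. 0 < r \<and> r \<le> 1 \<and> x \<in> A}"
  let ?A' = "reflect v -` A \<inter> sphere 0 1"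
  have Ab: "A \<in> sets borel" and AS: "A \<subseteq> sphere 0 1"
    using A by (auto simp: sphere_borel_def sets_restrict_space)
  have A': "?A' \<in> sets sphere_borel"
    using measurable_sets_borel[OF measurable_reflect Ab, of v]
    by (auto simp: sphere_borel_def sets_restrict_space)
  have S: "sphere (0::'a) 1 \<in> sets surface_measure"
    by (auto simp: sets_surface_measure sphere_borel_def sets_restrict_space)
  have sgn: "sgn (reflect v x) = reflect v (sgn x)" for x
    by (simp add: sgn_div_norm linear_scale[OF linear_reflect])
  have "?cone ?A' = reflect v -` ?cone A"
    using AS by (subst (1 2) cone_eq) (auto simp: sgn norm_sgn)
  moreover have "?cone A \<in> sets borel"
  proof -
    have "(sgn :: 'a \<Rightarrow> 'a) \<in> borel_measurable borel"
      unfolding sgn_div_norm by measurable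
    from measurable_sets_borel[OF this Ab] show ?thesis
      unfolding cone_eq[OF AS] by auto
  qed
  ultimately have "emeasure surface_measure ?A' = emeasure surface_measure A"
    by (simp only: emeasure_surface_measure A A' emeasure_lborel_reflect)
  then show ?thesis
    using A A' S AS unfolding normalized_surface_measure_def
    by (subst (1 2) emeasure_uniform_measure) (auto simp: sets_surface_measure Int_absorb1)
qed

lemma integral_reflect:
  fixes f :: "'a::euclidean_space \<Rightarrow> real"
  assumes f: "f \<in> borel_measurable \<sigma>"
  shows "(\<integral>x. f (reflect v x) \<partial>\<sigma>) = (\<integral>x. f x \<partial>\<sigma>)"
proof -
  note S = space_sphere_prob[OF sigma_in, where 'a = 'a]
    sets_sphere_prob[OF sigma_in, where 'a = 'a]
  have m: "reflect v \<in> measurable \<sigma> \<sigma>"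
    unfolding measurable_cong_sets[OF refl S(2)] sphere_borel_def
    by (intro measurable_restrict_space2 measurable_sphere_prob[OF sigma_in] measurable_reflect)
      (auto simp: S(1))
  have "distr \<sigma> \<sigma> (reflect v) = \<sigma>"
    by (rule measure_eqI)
      (auto simp: emeasure_distr[OF m] S emeasure_normalized_surface_measure_reflect)
  then show ?thesis using integral_distr[OF m f] by simp
qed

subsection \<open>Gegenbauer polynomials and their moment functional\<close>

text \<open>The polynomials \<open>C\<^sub>n\<^sup>l(t) / C\<^sub>n\<^sup>l(1)\<close>; their recurrence also makes sense for \<open>l = 0\<close>.\<close>

fun geg :: "real \<Rightarrow> nat \<Rightarrow> real poly" where
  "geg l 0 = 1"
| "geg l (Suc 0) = [:0, 1:]"
| "geg l (Suc (Suc n)) = smult (1 / (real n + 1 + 2 * l))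
     (smult (2 * (real n + 1 + l)) ([:0, 1:] * geg l (Suc n)) - smult (real n + 1) (geg l n))"

lemma geg_rec:
  assumes "l \<ge> 0"
  shows "smult (real n + 1 + 2 * l) (geg l (Suc (Suc n))) =
    smult (2 * (real n + 1 + l)) ([:0, 1:] * geg l (Suc n)) - smult (real n + 1) (geg l n)"
  using assms by simp

lemma poly_geg_1:
  assumes "l \<ge> 0"
  shows "poly (geg l n) 1 = 1"
  using assms by (induction l n rule: geg.induct) (auto simp: field_simps)

text \<open>Both sides obey the same three-term recurrence. For \<open>l = 0\<close> it is the
  addition formula cos((n+2)x) + cos(nx) = 2 cos x cos((n+1)x); for \<open>l > 0\<close> it is the
  recurrence of \<open>gegenbauer\<close> divided by the values at 1.\<close>

lemma gegenbauer_quotient_eq_geg: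
  assumes "l \<ge> 0" and t: "t \<in> {-1..1}"
  shows "gegenbauer_quotient n l t = poly (geg l n) t"
proof (cases "l = 0")
  case True
  have "cos (real n * arccos t) = poly (geg 0 n) t"
  proof (induction n rule: induct_nat_012)
    case (ge2 n)
    define x where "x = arccos t"
    have "cos ((real n + 2) * x) = 2 * cos x * cos ((real n + 1) * x) - cos (real n * x)"
      using cos_add[of "(real n + 1) * x" x] cos_diff[of "(real n + 1) * x" x]
      by (simp add: algebra_simps)
    moreover have "cos x = t" using t by (simp add: x_def)
    moreover have "(real n + 1) * poly (geg 0 (Suc (Suc n))) t =
        (real n + 1) * (2 * t * poly (geg 0 (Suc n)) t - poly (geg 0 n) t)"
      using arg_cong[OF geg_rec[of 0 n], of "\<lambda>p. poly p t"] by (simp del: geg.simps add: algebra_simps)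
    then have "poly (geg 0 (Suc (Suc n))) t = 2 * t * poly (geg 0 (Suc n)) t - poly (geg 0 n) t"
      unfolding mult_cancel_left by simp
    ultimately show ?case
      using ge2 by (simp add: x_def algebra_simps del: geg.simps)
  qed (use t in auto)
  then show ?thesis by (simp add: gegenbauer_quotient_def True)
next
  case False
  then have l: "l > 0" using assms by simp
  \<comment> \<open>The ratio of consecutive values at 1, proved jointly with positivity, since each
    value inherits its sign from its predecessor through this ratio.\<close>
  have *: "gegenbauer n l 1 > 0 \<and> gegenbauer (Suc n) l 1 * (real n + 1) = (real n + 2 * l) * gegenbauer n l 1"
    for n
  proof (induction n)
    case (Suc n)
    have "(real n + 2) * gegenbauer (Suc (Suc n)) l 1 =
        2 * (real n + 1 + l) * gegenbauer (Suc n) l 1 - (real n + 2 * l) * gegenbauer n l 1"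
      by simp
    also have "\<dots> = (real n + 1 + 2 * l) * gegenbauer (Suc n) l 1"
      using Suc by (simp add: algebra_simps)
    finally have "gegenbauer (Suc (Suc n)) l 1 * (real (Suc n) + 1) = (real (Suc n) + 2 * l) * gegenbauer (Suc n) l 1"
      by (simp only: of_nat_Suc algebra_simps)
    moreover have "gegenbauer (Suc n) l 1 = (real n + 2 * l) * gegenbauer n l 1 / (real n + 1)"
      using Suc by (simp add: field_simps)
    then have "gegenbauer (Suc n) l 1 > 0" using Suc l by simp
    ultimately show ?case by blast
  qed (use l in auto)
  have "gegenbauer n l t = gegenbauer n l 1 * poly (geg l n) t"
  proof (induction n rule: induct_nat_012)
    case (ge2 n)
    have "(real n + 2) * gegenbauer (Suc (Suc n)) l t =
        2 * (real n + 1 + l) * t * gegenbauer (Suc n) l t - (real n + 2 * l) * gegenbauer n l t"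
      by simp
    also have "\<dots> = 2 * (real n + 1 + l) * t * (gegenbauer (Suc n) l 1 * poly (geg l (Suc n)) t) -
        gegenbauer (Suc n) l 1 * (real n + 1) * poly (geg l n) t"
      using *[of n] ge2 by simp
    also have "\<dots> = gegenbauer (Suc n) l 1 * ((real n + 1 + 2 * l) * poly (geg l (Suc (Suc n))) t)"
    proof -
      have "(real n + 1 + 2 * l) * poly (geg l (Suc (Suc n))) t =
          2 * (real n + 1 + l) * (t * poly (geg l (Suc n)) t) - (real n + 1) * poly (geg l n) t"
        using arg_cong[OF geg_rec[of l n], of "\<lambda>p. poly p t"] l by (simp del: geg.simps)
      then show ?thesis by algebra
    qed
    also have "\<dots> = (real n + 2) * gegenbauer (Suc (Suc n)) l 1 * poly (geg l (Suc (Suc n))) t"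
      using conjunct2[OF *[of "Suc n"]] by (simp add: algebra_simps del: geg.simps gegenbauer.simps)
    finally show ?case by (simp del: geg.simps gegenbauer.simps)
  qed (use t in auto)
  then show ?thesis using *[of n] l by (simp add: gegenbauer_quotient_def)
qed

text \<open>Each step of the recurrence multiplies the leading coefficient by 2 (n + 1 + l) / (n + 1
  + 2 l) > 0. Exact degrees are what make the triangular expansion \<open>geg_expansion\<close>
  possible.\<close>

lemma degree_coeff_geg:
  assumes "l \<ge> 0"
  shows "degree (geg l n) = n \<and> coeff (geg l n) n > 0"
proof -
  have "degree (geg l n) \<le> n \<and> coeff (geg l n) n > 0"
    using assms
  proof (induction l n rule: geg.induct)
    case (3 l n)
    have "degree (smult (2 * (real n + 1 + l)) ([:0, 1:] * geg l (Suc n)) - smult (real n + 1) (geg l n))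
      \<le> Suc (Suc n)"
      using 3 by (intro degree_diff_le order_trans[OF degree_smult_le] order_trans[OF degree_mult_le]) auto
    moreover have "coeff (geg l n) (Suc (Suc n)) = 0"
      using 3 by (intro coeff_eq_0) auto
    moreover from this have "coeff (geg l (Suc (Suc n))) (Suc (Suc n)) =
        2 * (real n + 1 + l) / (real n + 1 + 2 * l) * coeff (geg l (Suc n)) (Suc n)"
      by simp
    moreover have "\<dots> > 0"
      using 3 by (intro mult_pos_pos divide_pos_pos) auto
    ultimately show ?case
      using 3(3) order_trans[OF degree_smult_le] by auto
  qed auto
  then show ?thesis using le_degree[of "geg l n" n] by fastforce
qed

lemma geg_expansion:
  assumes "l \<ge> 0" "degree p \<le> n"
  shows "\<exists>a. p = (\<Sum>m\<le>n. smult (a m) (geg l m))"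
  using assms(2)
proof (induction n arbitrary: p)
  case 0
  then show ?case by (auto elim!: degree_eq_zeroE simp: one_pCons)
next
  case (Suc n)
  define c where "c = coeff p (Suc n) / coeff (geg l (Suc n)) (Suc n)"
  note g = degree_coeff_geg[OF assms(1), of "Suc n"]
  have "degree (p - smult c (geg l (Suc n))) \<le> n"
  proof (rule degree_le, intro allI impI)
    fix i assume "n < i"
    show "coeff (p - smult c (geg l (Suc n))) i = 0"
    proof (cases "i = Suc n")
      case True
      then show ?thesis using g by (simp add: c_def)
    next
      case False
      then have "Suc n < i" using \<open>n < i\<close> by simp
      then show ?thesis using Suc.prems g by (simp add: coeff_eq_0 del: geg.simps)
    qed
  qed
  then obtain a where a: "p - smult c (geg l (Suc n)) = (\<Sum>m\<le>n. smult (a m) (geg l m))"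
    using Suc.IH by blast
  have "p = (\<Sum>m\<le>Suc n. smult ((a(Suc n := c)) m) (geg l m))"
    using a by (simp del: geg.simps add: algebra_simps)
  then show ?case by blast
qed

text \<open>Differentiating the recurrence brings in the derivatives at two lower degrees, hence
  strong induction. In \<open>geg_mean_zero\<close> this relation is what \<open>by_parts\<close> is
  applied to.\<close>

lemma pderiv_geg:
  assumes "l \<ge> 0"
  shows "(1 - t\<^sup>2) * poly (pderiv (geg l (Suc n))) t =
    (real n + 1) * (poly (geg l n) t - t * poly (geg l (Suc n)) t)"
proof (induction n rule: less_induct)
  case (less n)
  show ?case
  proof (cases n)
    case 0
    then show ?thesis by (simp add: pderiv_pCons power2_eq_square)
  next
    case (Suc k)
    define P Q R where "P = geg l (Suc (Suc k))" and "Q = geg l (Suc k)" and "R = geg l k"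
    define p q r p' q' r' where "p = poly P t" and "q = poly Q t" and "r = poly R t"
      and "p' = poly (pderiv P) t" and "q' = poly (pderiv Q) t" and "r' = poly (pderiv R) t"
    have c: "real k + 1 + 2 * l \<noteq> 0" using assms by simp
    have rec: "smult (real k + 1 + 2 * l) P = smult (2 * (real k + 1 + l)) ([:0, 1:] * Q) - smult (real k + 1) R"
      unfolding P_def Q_def R_def by (rule geg_rec[OF assms])
    have rec1: "(real k + 1 + 2 * l) * p = 2 * (real k + 1 + l) * t * q - (real k + 1) * r"
      using arg_cong[OF rec, of "\<lambda>p. poly p t"] by (simp add: p_def q_def r_def)
    have rec2: "(real k + 1 + 2 * l) * p' = 2 * (real k + 1 + l) * (q + t * q') - (real k + 1) * r'"
      using arg_cong[OF rec, of "\<lambda>p. poly (pderiv p) t"]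
      by (simp add: p'_def q_def q'_def r'_def pderiv_smult pderiv_diff pderiv_pCons algebra_simps)
    have Q': "(1 - t\<^sup>2) * q' = (real k + 1) * (r - t * q)"
      using less.IH[of k] Suc unfolding q_def q'_def r_def Q_def R_def by simp
    \<comment> \<open>The downward companion of the relation: the induction hypothesis at
      \<open>j = k - 1\<close>, with \<open>geg l j\<close> eliminated by the recurrence. For
      \<open>k = 0\<close> both sides are 0.\<close>
    have R': "(1 - t\<^sup>2) * r' = (real k + 2 * l) * (t * r - q)"
    proof (cases k)
      case 0
      then show ?thesis by (simp add: r_def q_def r'_def R_def Q_def)
    next
      case (Suc j)
      define s where "s = poly (geg l j) t"
      have "(1 - t\<^sup>2) * r' = (real j + 1) * (s - t * r)"
        using less.IH[of j] Suc \<open>n = Suc k\<close> unfolding r_def r'_def s_def R_def by simp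
      moreover have "(real j + 1 + 2 * l) * q = 2 * (real j + 1 + l) * t * r - (real j + 1) * s"
        using arg_cong[OF geg_rec[OF assms, of j], of "\<lambda>p. poly p t"]
        unfolding q_def r_def s_def Q_def R_def Suc by (simp del: geg.simps)
      ultimately show ?thesis using Suc by (simp add: algebra_simps)
    qed
    have "(real k + 1 + 2 * l) * ((1 - t\<^sup>2) * p') =
        2 * (real k + 1 + l) * ((1 - t\<^sup>2) * q + t * ((1 - t\<^sup>2) * q')) - (real k + 1) * ((1 - t\<^sup>2) * r')"
      using rec2 by algebra
    also have "\<dots> = (real k + 2) * ((real k + 1 + 2 * l) * q - t * ((real k + 1 + 2 * l) * p))"
      unfolding Q' R' rec1 by algebra
    also have "\<dots> = (real k + 1 + 2 * l) * ((real k + 2) * (q - t * p))"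
      by algebra
    finally have "(1 - t\<^sup>2) * p' = (real k + 2) * (q - t * p)"
      using c unfolding mult_cancel_left by simp
    then show ?thesis by (simp add: Suc p_def p'_def q_def P_def Q_def del: geg.simps)
  qed
qed

text \<open>The mean against the normalised weight (1 - t^2)^(l - 1/2), described by its moments
  alone: \<open>moment_rec\<close> is partial integration of the derivative of t^(k+1) (1 - t^2)^(l
  + 1/2). It is instantiated by the spherical mean and by the weighted integral.\<close>

locale gegenbauer_functional =
  fixes l :: real and L :: "real poly \<Rightarrow> real"
  assumes l: "l \<ge> 0"
    and add: "L (p + q) = L p + L q"
    and smult: "L (smult c p) = c * L p"
    and one: "L 1 = 1"
    and moment_1: "L (monom 1 1) = 0"
    and moment_rec: "(real k + 1) * (L (monom 1 k) - L (monom 1 (k + 2))) = (2 * l + 1) * L (monom 1 (k + 2))"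
begin

lemma zero [simp]: "L 0 = 0"
  using smult[of 0 0] by simp

lemma diff: "L (p - q) = L p - L q"
  using add[of p "smult (-1) q"] smult[of "-1" q] by simp

lemma sum: "L (\<Sum>i\<in>A. f i) = (\<Sum>i\<in>A. L (f i))"
  by (induction A rule: infinite_finite_induct) (simp_all add: add)

lemma eq_sum_moments: "L p = (\<Sum>i\<le>degree p. coeff p i * L (monom 1 i))"
proof -
  have "p = (\<Sum>i\<le>degree p. smult (coeff p i) (monom 1 i))"
    using poly_as_sum_of_monoms[of p] by (simp add: smult_monom)
  from arg_cong[OF this, of L] show ?thesis by (simp add: sum smult)
qed

text \<open>Integration by parts against \<open>(1 - t\<^sup>2) powr (l + 1/2)\<close>.\<close>

lemma by_parts: "L ([:1, 0, -1:] * pderiv q) = (2 * l + 1) * L ([:0, 1:] * q)"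
proof -
  have mono: "L ([:1, 0, -1:] * pderiv (monom 1 k)) = (2 * l + 1) * L ([:0, 1:] * monom 1 k)" for k
  proof (cases k)
    case 0
    then show ?thesis using moment_1 by (simp add: monom_altdef)
  next
    case (Suc j)
    have "[:1, 0, -1:] * pderiv (monom 1 k) = smult (real j + 1) (monom 1 j - monom 1 (j + 2))"
      by (rule poly_ext) (simp add: Suc pderiv_monom poly_monom power2_eq_square algebra_simps)
    moreover have "[:0, 1:] * monom 1 k = (monom 1 (j + 2) :: real poly)"
      by (rule poly_ext) (simp add: Suc poly_monom)
    ultimately show ?thesis using moment_rec[of j] by (simp only: smult diff)
  qed
  have q: "q = (\<Sum>i\<le>degree q. smult (coeff q i) (monom 1 i))"
    using poly_as_sum_of_monoms[of q] by (simp add: smult_monom)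
  have pderiv_sum: "pderiv (\<Sum>i\<in>A. f i) = (\<Sum>i\<in>A. pderiv (f i))" for A and f :: "nat \<Rightarrow> real poly"
    by (induction A rule: infinite_finite_induct) (simp_all add: pderiv_add)
  show ?thesis
    by (subst (1 2) q, simp only: pderiv_sum pderiv_smult sum_distrib_left mult_smult_right sum smult mono)
      (simp add: sum_distrib_left algebra_simps)
qed

text \<open>Partial integration and the recurrence are two linear equations between L(P_n), L(t
  P_(n+1)) and L(P_(n+2)). Solving them expresses L(P_(n+2)) as a multiple of n L(P_n).\<close>

lemma geg_mean_zero: "n \<ge> 1 \<Longrightarrow> L (geg l n) = 0"
proof (induction n rule: induct_nat_012)
  case 1
  then show ?case using moment_1 by (simp add: monom_altdef)
next
  case (ge2 n)
  have "[:1, 0, -1:] * pderiv (geg l (Suc n)) = smult (real n + 1) (geg l n - [:0, 1:] * geg l (Suc n))"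
    using pderiv_geg[OF l, of _ n] by (intro poly_ext) (simp add: power2_eq_square algebra_simps del: geg.simps)
  then have "(real n + 1) * (L (geg l n) - L ([:0, 1:] * geg l (Suc n))) = (2 * l + 1) * L ([:0, 1:] * geg l (Suc n))"
    using by_parts[of "geg l (Suc n)"] by (simp only: smult diff)
  moreover have "(real n + 1 + 2 * l) * L (geg l (Suc (Suc n))) =
      2 * (real n + 1 + l) * L ([:0, 1:] * geg l (Suc n)) - (real n + 1) * L (geg l n)"
    using arg_cong[OF geg_rec[OF l, of n], of L] by (simp only: smult diff)
  ultimately have "(real n + 1 + 2 * l) * L (geg l (Suc (Suc n))) = real n * L ([:0, 1:] * geg l (Suc n))"
    and "(real n + 2 + 2 * l) * L ([:0, 1:] * geg l (Suc n)) = (real n + 1) * L (geg l n)"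
    by algebra+
  \<comment> \<open>For \<open>n = 0\<close> the factor \<open>n\<close> kills the term, although
    L(P_0) = 1; for \<open>n > 0\<close> the induction hypothesis does.\<close>
  moreover from this(2) have "real n * L ([:0, 1:] * geg l (Suc n)) = 0"
    using ge2 l by (cases n) auto
  ultimately have "(real n + 1 + 2 * l) * L (geg l (Suc (Suc n))) = 0" by simp
  then show ?case using l by (simp del: geg.simps)
qed simp

text \<open>One factor t moves from the monomial to \<open>geg l n\<close>, where the recurrence
  turns it into a combination of the neighbours n + 1 and n - 1. Both indices still exceed the
  lowered exponent.\<close>

lemma geg_orthogonal_monom: "k < n \<Longrightarrow> L (monom 1 k * geg l n) = 0"
proof (induction k arbitrary: n)
  case 0
  then show ?case using geg_mean_zero[of n] by simp
next
  case (Suc k)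
  then obtain j where n: "n = Suc j" "k < j" by (cases n) auto
  have "monom 1 (Suc k) * geg l n = monom 1 k * ([:0, 1:] * geg l (Suc j))"
    unfolding n by (rule poly_ext) (simp add: poly_monom del: geg.simps)
  moreover have "L (monom 1 k * smult (real j + 1 + 2 * l) (geg l (Suc (Suc j)))) = 0"
    using Suc.IH[of "Suc (Suc j)"] n by (simp add: smult del: geg.simps)
  then have "2 * (real j + 1 + l) * L (monom 1 k * ([:0, 1:] * geg l (Suc j))) - (real j + 1) * L (monom 1 k * geg l j) = 0"
    unfolding geg_rec[OF l] by (simp only: right_diff_distrib mult_smult_right smult diff)
  ultimately show ?case using Suc.IH[of j] n l by simp
qed

lemma geg_orthogonal:
  assumes "degree q < n"
  shows "L (q * geg l n) = 0"
proof -
  have q: "q = (\<Sum>i\<le>degree q. smult (coeff q i) (monom 1 i))"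
    using poly_as_sum_of_monoms[of q] by (simp add: smult_monom)
  show ?thesis
    using assms by (subst q) (simp add: sum_distrib_right sum smult geg_orthogonal_monom)
qed

text \<open>Positivity of \<open>L\<close> is not an axiom of the locale; it comes from the
  recurrence. By orthogonality L(P_(n+2)^2) and L(P_(n+1)^2) are both positive multiples of L(t
  P_(n+1) P_(n+2)).\<close>

lemma geg_norm_pos: "L (geg l n * geg l n) > 0"
proof (induction n rule: induct_nat_012)
  case 0
  then show ?case by (simp add: one)
next
  case 1
  have "(2 * l + 2) * L (monom 1 2) = 1"
    using moment_rec[of 0] one by (simp add: algebra_simps numeral_2_eq_2)
  then have "L (monom 1 2) > 0" using l by (metis add_nonneg_pos mult_nonneg_nonneg zero_le_numeral zero_less_mult_pos zero_less_numeral zero_less_one)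
  then show ?case by (simp add: monom_altdef power2_eq_square)
next
  case (ge2 n)
  define X :: "real poly" where "X = [:0, 1:]"
  let ?P = "\<lambda>n. geg l n"
  have o: "L (?P m * ?P k) = 0" if "m < k" for m k
    using that degree_coeff_geg[OF l, of m] by (intro geg_orthogonal) auto
  have "(real n + 1 + 2 * l) * L (?P (Suc (Suc n)) * ?P (Suc (Suc n))) =
    L (smult (real n + 1 + 2 * l) (?P (Suc (Suc n))) * ?P (Suc (Suc n)))"
    by (simp only: smult mult_smult_left)
  also have "\<dots> = 2 * (real n + 1 + l) * L (X * ?P (Suc n) * ?P (Suc (Suc n)))"
    unfolding geg_rec[OF l] X_def
    by (simp only: left_diff_distrib mult_smult_left smult diff o[of n "Suc (Suc n)"])
  finally have 1: "(real n + 1 + 2 * l) * L (?P (Suc (Suc n)) * ?P (Suc (Suc n))) =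
    2 * (real n + 1 + l) * L (X * ?P (Suc n) * ?P (Suc (Suc n)))" .
  have "0 = L (?P (Suc n) * smult (real (Suc n) + 1 + 2 * l) (?P (Suc (Suc (Suc n)))))"
    by (simp only: smult mult_smult_right o[of "Suc n" "Suc (Suc (Suc n))"]; simp)
  also have "\<dots> = 2 * (real n + 2 + l) * L (X * ?P (Suc n) * ?P (Suc (Suc n))) -
     (real n + 2) * L (?P (Suc n) * ?P (Suc n))"
    unfolding geg_rec[OF l] X_def
    by (simp only: right_diff_distrib mult_smult_right smult diff mult.assoc mult.left_commute)
      (simp add: algebra_simps del: geg.simps)
  finally have "L (X * ?P (Suc n) * ?P (Suc (Suc n))) = (real n + 2) * L (?P (Suc n) * ?P (Suc n)) / (2 * (real n + 2 + l))"
    using l by (simp add: field_simps)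
  also have "\<dots> > 0" using ge2 l by simp
  finally have "0 < (real n + 1 + 2 * l) * L (?P (Suc (Suc n)) * ?P (Suc (Suc n)))"
    unfolding 1 using l by simp
  then show ?case using l by (simp add: zero_less_mult_iff)
qed

text \<open>Serves to recognise eigenfunctions: the image of \<open>geg l n\<close> under a
  convolution satisfies both assumptions, and the factor is its value at 1 because
  \<open>geg l n\<close> equals 1 there.\<close>

lemma orthogonal_imp_multiple_geg:
  assumes "degree p \<le> n" and o: "\<And>q. degree q < n \<Longrightarrow> L (q * p) = 0"
  shows "p = smult (poly p 1) (geg l n)"
proof -
  obtain a where a: "p = (\<Sum>m\<le>n. smult (a m) (geg l m))"
    using geg_expansion[OF l assms(1)] by blast
  have geg_o: "L (geg l m * geg l k) = 0" if "m \<noteq> k" for m k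
    using that geg_orthogonal[of "geg l m" k] geg_orthogonal[of "geg l k" m] degree_coeff_geg[OF l]
    by (cases m k rule: linorder_cases) (auto simp: mult.commute)
  have "a k = 0" if "k < n" for k
  proof -
    have "0 = L (geg l k * p)"
      using that degree_coeff_geg[OF l, of k] by (intro o[symmetric]) auto
    also have "\<dots> = (\<Sum>m\<le>n. a m * L (geg l k * geg l m))"
      by (subst a) (simp only: sum_distrib_left mult_smult_right sum smult)
    also have "\<dots> = (\<Sum>m\<le>n. if m = k then a k * L (geg l k * geg l k) else 0)"
      by (intro sum.cong) (auto simp: geg_o)
    also have "\<dots> = a k * L (geg l k * geg l k)"
      using that by (simp add: sum.delta)
    finally show ?thesis using geg_norm_pos[of k] by simp
  qed
  then have "p = (\<Sum>m\<le>n. if m = n then smult (a n) (geg l n) else 0)"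
    by (subst a) (intro sum.cong, auto)
  then have p: "p = smult (a n) (geg l n)" by (simp add: sum.delta)
  have "poly p 1 = a n" unfolding p by (simp add: poly_geg_1[OF l])
  then show ?thesis using p by (simp only:)
qed

end

lemma gegenbauer_functional_unique:
  assumes "gegenbauer_functional l L" "gegenbauer_functional l M"
  shows "L p = M p"
proof -
  interpret L: gegenbauer_functional l L by fact
  interpret M: gegenbauer_functional l M by fact
  have "L (monom 1 k) = M (monom 1 k)" for k
  proof (induction k rule: induct_nat_012)
    case 0
    then show ?case using L.one M.one by simp
  next
    case 1
    then show ?case using L.moment_1 M.moment_1 by simp
  next
    case (ge2 k)
    have "(real k + 2 + 2 * l) * L (monom 1 (k + 2)) = (real k + 2 + 2 * l) * M (monom 1 (k + 2))"
      using L.moment_rec[of k] M.moment_rec[of k] ge2 by (simp add: algebra_simps)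
    then show ?case using L.l by simp
  qed
  then show ?thesis by (simp add: L.eq_sum_moments[of p] M.eq_sum_moments[of p])
qed

subsection \<open>Integrals of continuous functions over the sphere\<close>

lemma continuous_bounded_on_unit:
  fixes F :: "real \<Rightarrow> real"
  assumes "continuous_on UNIV F"
  obtains B where "B > 0" "\<And>t. \<bar>t\<bar> \<le> 1 \<Longrightarrow> \<bar>F t\<bar> \<le> B"
proof -
  have "compact (F ` {-1..1})"
    by (intro compact_continuous_image continuous_on_subset[OF assms]) auto
  then obtain B where "B > 0" "\<And>y. y \<in> F ` {-1..1} \<Longrightarrow> norm y \<le> B"
    using compact_imp_bounded bounded_pos by metis
  then show ?thesis by (intro that[of B]) (auto simp: abs_le_iff)
qed

lemma abs_inner_unit_le: "norm x = 1 \<Longrightarrow> norm y = 1 \<Longrightarrow> \<bar>x \<bullet> y\<bar> \<le> 1"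
  using Cauchy_Schwarz_ineq2[of x y] by simp

lemma
  fixes f :: "'a::euclidean_space \<Rightarrow> 'a \<Rightarrow> real"
  assumes f: "continuous_on UNIV (\<lambda>(x, y). f x y)"
  shows bounded_pair_continuous: "\<exists>B. \<forall>x y. norm x = 1 \<longrightarrow> norm y = 1 \<longrightarrow> \<bar>f x y\<bar> \<le> B"
    and measurable_pair_continuous: "\<lbrakk>\<mu> \<in> sphere_prob_measures; \<nu> \<in> sphere_prob_measures\<rbrakk>
      \<Longrightarrow> (\<lambda>(x, y). f x y) \<in> borel_measurable (\<mu> \<Otimes>\<^sub>M \<nu>)"
proof -
  have "compact ((\<lambda>(x, y). f x y) ` (sphere 0 1 \<times> sphere 0 1))"
    by (intro compact_continuous_image continuous_on_subset[OF f] compact_Times) auto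
  then obtain B where "\<And>y. y \<in> (\<lambda>(x, y). f x y) ` (sphere 0 1 \<times> sphere 0 1) \<Longrightarrow> norm y \<le> B"
    using compact_imp_bounded bounded_pos by metis
  then show "\<exists>B. \<forall>x y. norm x = 1 \<longrightarrow> norm y = 1 \<longrightarrow> \<bar>f x y\<bar> \<le> B"
    by (intro exI[of _ B]) force
next
  assume m: "\<mu> \<in> sphere_prob_measures" "\<nu> \<in> sphere_prob_measures"
  have "(\<lambda>z. (fst z, snd z)) \<in> measurable (\<mu> \<Otimes>\<^sub>M \<nu>) (borel \<Otimes>\<^sub>M borel)"
    by (intro measurable_Pair measurable_compose[OF measurable_fst measurable_ident_sphere_prob[OF m(1)]]
        measurable_compose[OF measurable_snd measurable_ident_sphere_prob[OF m(2)]])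
  moreover have "(\<lambda>(x, y). f x y) \<in> borel_measurable (borel \<Otimes>\<^sub>M borel)"
    unfolding borel_prod by (rule borel_measurable_continuous_onI[OF f])
  ultimately show "(\<lambda>(x, y). f x y) \<in> borel_measurable (\<mu> \<Otimes>\<^sub>M \<nu>)"
    using measurable_compose by fastforce
qed

lemma measurable_continuous_sphere:
  "\<lbrakk>\<mu> \<in> sphere_prob_measures; continuous_on UNIV f\<rbrakk> \<Longrightarrow> f \<in> borel_measurable \<mu>"
  by (rule measurable_sphere_prob[OF _ borel_measurable_continuous_onI])

lemma integrable_continuous_sphere:
  fixes f :: "'a::euclidean_space \<Rightarrow> real"
  assumes "\<mu> \<in> sphere_prob_measures" "continuous_on UNIV f"
  shows "integrable \<mu> f"
proof -
  have "compact (f ` sphere 0 1)"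
    by (intro compact_continuous_image continuous_on_subset[OF assms(2)]) auto
  then obtain B where "\<And>y. y \<in> f ` sphere 0 1 \<Longrightarrow> norm y \<le> B"
    using compact_imp_bounded bounded_pos by metis
  then show ?thesis
    by (intro integrable_sphere_prob[where B = B] assms measurable_continuous_sphere) auto
qed

lemma integral_swap_continuous:
  fixes f :: "'a::euclidean_space \<Rightarrow> 'a \<Rightarrow> real"
  assumes \<mu>: "\<mu> \<in> sphere_prob_measures" and \<nu>: "\<nu> \<in> sphere_prob_measures"
    and f: "continuous_on UNIV (\<lambda>(x, y). f x y)"
  shows "(\<integral>y. (\<integral>x. f x y \<partial>\<mu>) \<partial>\<nu>) = (\<integral>x. (\<integral>y. f x y \<partial>\<nu>) \<partial>\<mu>)"
  using bounded_pair_continuous[OF f]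
  by (auto intro: integral_swap_sphere_prob[OF \<mu> \<nu> measurable_pair_continuous[OF f \<mu> \<nu>]])

lemma
  fixes f :: "'a::euclidean_space \<Rightarrow> 'a \<Rightarrow> real"
  assumes \<mu>: "\<mu> \<in> sphere_prob_measures" and \<nu>: "\<nu> \<in> sphere_prob_measures"
    and f: "continuous_on UNIV (\<lambda>(x, y). f x y)"
  shows measurable_inner_integral: "(\<lambda>x. \<integral>y. f x y \<partial>\<nu>) \<in> borel_measurable \<mu>"
    and integrable_inner_integral: "integrable \<mu> (\<lambda>x. \<integral>y. f x y \<partial>\<nu>)"
proof -
  interpret prob_space \<nu> by (rule prob_space_sphere_prob[OF \<nu>])
  show m: "(\<lambda>x. \<integral>y. f x y \<partial>\<nu>) \<in> borel_measurable \<mu>"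
    by (rule borel_measurable_lebesgue_integral[OF measurable_pair_continuous[OF f \<mu> \<nu>]])
  obtain B where "\<And>x y. norm x = 1 \<Longrightarrow> norm y = 1 \<Longrightarrow> \<bar>f x y\<bar> \<le> B"
    using bounded_pair_continuous[OF f] by blast
  then show "integrable \<mu> (\<lambda>x. \<integral>y. f x y \<partial>\<nu>)"
    by (intro integrable_sphere_prob[OF \<mu> m, where B = B] abs_integral_sphere_prob_le[OF \<nu>])
qed

lemma continuous_on_poly_comp [continuous_intros]:
  fixes f :: "'a::topological_space \<Rightarrow> real"
  shows "continuous_on S f \<Longrightarrow> continuous_on S (\<lambda>x. poly p (f x))"
  by (rule continuous_on_compose2[of UNIV "poly p"]) (auto intro: continuous_at_imp_continuous_on)

subsection \<open>Zonal functions\<close>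

definition zonal_mean :: "'a::euclidean_space \<Rightarrow> (real \<Rightarrow> real) \<Rightarrow> real" where
  "zonal_mean x F = (\<integral>y. F (x \<bullet> y) \<partial>\<sigma>)"

text \<open>Two reflections suffice. The first moves \<open>x\<close> to \<open>x'\<close>; the
  image of \<open>u\<close> is then a unit vector orthogonal to \<open>x'\<close>, and the
  reflection taking it to \<open>u'\<close> has its axis orthogonal to \<open>x'\<close>, hence
  fixes \<open>x'\<close>.\<close>

lemma integral_orthonormal_pair:
  fixes x u x' u' :: "'a::euclidean_space"
  assumes f: "continuous_on UNIV (\<lambda>(s, t). f s t :: real)"
    and unit: "norm x = 1" "norm u = 1" "norm x' = 1" "norm u' = 1"
    and orth: "x \<bullet> u = 0" "x' \<bullet> u' = 0"
  shows "(\<integral>y. f (x \<bullet> y) (u \<bullet> y) \<partial>\<sigma>) = (\<integral>y. f (x' \<bullet> y) (u' \<bullet> y) \<partial>\<sigma>)"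
proof -
  have *: "(\<integral>y. f (x \<bullet> y) (u \<bullet> y) \<partial>\<sigma>) = (\<integral>y. f (reflect v x \<bullet> y) (reflect v u \<bullet> y) \<partial>\<sigma>)"
    for v x u :: 'a
  proof -
    have "continuous_on UNIV (\<lambda>y. case (reflect v x \<bullet> y, reflect v u \<bullet> y) of (s, t) \<Rightarrow> f s t)"
      by (rule continuous_on_compose2[OF f]) (auto intro!: continuous_intros)
    then have "(\<lambda>y. f (reflect v x \<bullet> y) (reflect v u \<bullet> y)) \<in> borel_measurable \<sigma>"
      by (intro measurable_continuous_sphere sigma_in) simp
    from integral_reflect[OF this, of v] show ?thesis
      by (simp add: inner_reflect_reflect)
  qed
  let ?u = "reflect (x - x') u"
  have x: "reflect (x - x') x = x'" by (rule reflect_diff) (simp add: unit)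
  have "x' \<bullet> ?u = 0" using inner_reflect_reflect[of "x - x'" x u] orth x by simp
  then have "reflect (?u - u') x' = x'"
    using orth by (intro reflect_eq_self) (simp add: inner_diff_right inner_commute[of _ x'])
  moreover have "reflect (?u - u') ?u = u'" by (rule reflect_diff) (simp add: unit)
  ultimately show ?thesis
    using *[of x u "x - x'"] *[of x' ?u "?u - u'"] x by simp
qed

lemma zonal_mean_eq:
  fixes x x' :: "'a::euclidean_space"
  assumes F: "continuous_on UNIV F" and unit: "norm x = 1" "norm x' = 1"
  shows "zonal_mean x F = zonal_mean x' F"
proof -
  have "(\<lambda>y. F (x' \<bullet> y)) \<in> borel_measurable \<sigma>"
    by (intro measurable_continuous_sphere sigma_in continuous_on_compose2[OF F] continuous_intros) auto
  from integral_reflect[OF this, of "x - x'"] show ?thesis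
    using reflect_diff[of x x'] unit inner_reflect_reflect[of "x - x'" x]
    unfolding zonal_mean_def by simp
qed

lemma prob_space_sigma: "prob_space (\<sigma> :: 'a::euclidean_space measure)"
  by (rule prob_space_sphere_prob[OF sigma_in])

text \<open>With DIM = d + 1 the value of \<open>l\<close> is (d - 1)/2. The pole \<open>e\<close>
  is the point at which zonal means are evaluated; \<open>dim\<close> gives l >= 0 and a basis
  vector orthogonal to \<open>e\<close>.\<close>

locale zonal =
  fixes e :: "'a::euclidean_space" and l :: real
  assumes e: "e \<in> Basis" and dim: "DIM('a) \<ge> 2" and l_eq: "l = (real DIM('a) - 2) / 2"
begin

lemma norm_e: "norm e = 1" using e by simp

abbreviation mean :: "(real \<Rightarrow> real) \<Rightarrow> real" where
  "mean \<equiv> zonal_mean e"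

lemma mean_eq: "\<lbrakk>continuous_on UNIV F; norm x = 1\<rbrakk> \<Longrightarrow> (\<integral>y. F (x \<bullet> y) \<partial>\<sigma>) = mean F" for x :: 'a
  using zonal_mean_eq[of F x e] norm_e by (simp add: zonal_mean_def)

lemma integrable_mean:
  fixes x :: 'a and F :: "real \<Rightarrow> real"
  assumes "continuous_on UNIV F"
  shows "integrable \<sigma> (\<lambda>y. F (x \<bullet> y))"
  by (rule integrable_continuous_sphere[OF sigma_in], rule continuous_on_compose2[OF assms])
    (auto intro!: continuous_intros)

lemma mean_const: "mean (\<lambda>_. c) = c"
  using prob_space.prob_space[OF prob_space_sigma[where 'a = 'a]] by (simp add: zonal_mean_def)

lemma integral_inner_power: "(\<integral>y. (w \<bullet> y) ^ n \<partial>\<sigma>) = norm w ^ n * mean (\<lambda>t. t ^ n)" for w :: 'a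
proof (cases "w = 0")
  case True
  show ?thesis
  proof (cases n)
    case 0
    then show ?thesis using mean_const[of 1] prob_space.prob_space[OF prob_space_sigma] by simp
  qed (simp add: True)
next
  case False
  have "(\<integral>y. (w \<bullet> y) ^ n \<partial>\<sigma>) = (\<integral>y. norm w ^ n * (sgn w \<bullet> y) ^ n \<partial>\<sigma>)"
    using False by (intro Bochner_Integration.integral_cong) (auto simp: sgn_div_norm power_mult_distrib[symmetric] mult.assoc[symmetric])
  also have "\<dots> = norm w ^ n * mean (\<lambda>t. t ^ n)"
    using False by (simp add: mean_eq[of "\<lambda>t. t ^ n"] continuous_intros norm_sgn)
  finally show ?thesis .
qed

lemma coeff_power_quadratic:
  "coeff ([:1, 0, 1:] ^ m :: real poly) 0 = 1"
  "coeff ([:1, 0, 1:] ^ m :: real poly) (Suc 0) = 0"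
  "coeff ([:1, 0, 1:] ^ m :: real poly) (Suc (Suc 0)) = real m"
proof -
  have "coeff ([:1, 0, 1:] ^ m :: real poly) 0 = 1 \<and> coeff ([:1, 0, 1:] ^ m :: real poly) (Suc 0) = 0
    \<and> coeff ([:1, 0, 1:] ^ m :: real poly) (Suc (Suc 0)) = real m"
    by (induction m) (auto simp: one_pCons)
  then show "coeff ([:1, 0, 1:] ^ m :: real poly) 0 = 1"
    "coeff ([:1, 0, 1:] ^ m :: real poly) (Suc 0) = 0"
    "coeff ([:1, 0, 1:] ^ m :: real poly) (Suc (Suc 0)) = real m" by auto
qed

text \<open>Compare the coefficients of \<open>\<tau>\<^sup>2\<close> in \<open>\<integral>((e + \<tau> b) \<bullet> y) ^ (2 * m) = (1 + \<tau>\<^sup>2) ^ m * mean (\<lambda>t. t ^ (2 * m))\<close>.\<close>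

lemma mixed_moment:
  assumes b: "b \<in> Basis" "b \<noteq> e"
  shows "(2 * real j + 1) * (\<integral>y. (e \<bullet> y) ^ (2 * j) * (b \<bullet> y)\<^sup>2 \<partial>\<sigma>) = mean (\<lambda>t. t ^ (2 * j + 2))"
proof -
  define m where "m = Suc j"
  define M where "M = (\<lambda>i. (\<integral>y. (b \<bullet> y) ^ i * (e \<bullet> y) ^ (2 * m - i) \<partial>(\<sigma> :: 'a measure)))"
  define p where "p = (\<Sum>i\<le>2 * m. monom (real (2 * m choose i) * M i) i)"
  have "poly p \<tau> = poly (smult (mean (\<lambda>t. t ^ (2 * m))) ([:1, 0, 1:] ^ m)) \<tau>" for \<tau>
  proof -
    have "(norm (\<tau> *\<^sub>R b + e))\<^sup>2 = 1 + \<tau>\<^sup>2"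
      unfolding power2_norm_eq_inner using b e
      by (simp add: inner_add_left inner_add_right inner_Basis power2_eq_square)
    then have "norm (\<tau> *\<^sub>R b + e) ^ (2 * m) = (1 + \<tau>\<^sup>2) ^ m"
      by (simp add: power_mult)
    then have "poly (smult (mean (\<lambda>t. t ^ (2 * m))) ([:1, 0, 1:] ^ m)) \<tau> = (\<integral>y. ((\<tau> *\<^sub>R b + e) \<bullet> y) ^ (2 * m) \<partial>\<sigma>)"
      unfolding integral_inner_power by (simp add: poly_power power2_eq_square)
    also have "\<dots> = (\<integral>y. (\<Sum>i\<le>2 * m. real (2 * m choose i) * \<tau> ^ i * ((b \<bullet> y) ^ i * (e \<bullet> y) ^ (2 * m - i))) \<partial>\<sigma>)"
      unfolding inner_add_left inner_scaleR_left binomial_ring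
      by (intro Bochner_Integration.integral_cong sum.cong refl) (simp add: power_mult_distrib)
    also have "\<dots> = (\<Sum>i\<le>2 * m. real (2 * m choose i) * \<tau> ^ i * M i)"
      unfolding M_def
      by (subst Bochner_Integration.integral_sum)
        (auto intro!: integrable_continuous_sphere sigma_in continuous_intros)
    also have "\<dots> = poly p \<tau>"
      by (simp add: p_def poly_sum poly_monom algebra_simps)
    finally show ?thesis by simp
  qed
  then have "p = smult (mean (\<lambda>t. t ^ (2 * m))) ([:1, 0, 1:] ^ m)"
    by (rule poly_ext)
  then have "coeff p 2 = real m * mean (\<lambda>t. t ^ (2 * m))"
    by (simp add: numeral_2_eq_2 coeff_power_quadratic)
  moreover have "2 \<le> 2 * m" by (simp add: m_def)
  then have "coeff p 2 = real (2 * m choose 2) * M 2"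
    by (simp add: p_def coeff_sum)
  \<comment> \<open>As m = j + 1, the binomial coefficient is m (2m - 1) = m (2j + 1). Its factor m
    cancels against the coefficient m of tau^2 in (1 + tau^2)^m.\<close>
  moreover have "real (2 * m choose 2) = real m * (2 * real j + 1)"
    by (simp add: choose_two m_def algebra_simps)
  ultimately have "real m * ((2 * real j + 1) * M 2) = real m * mean (\<lambda>t. t ^ (2 * m))"
    by simp
  moreover have "M 2 = (\<integral>y. (e \<bullet> y) ^ (2 * j) * (b \<bullet> y)\<^sup>2 \<partial>\<sigma>)"
    unfolding M_def m_def by (simp add: mult.commute)
  ultimately show ?thesis unfolding m_def by simp
qed

lemma mean_odd_power: "odd k \<Longrightarrow> mean (\<lambda>t. t ^ k) = 0"
proof -
  assume k: "odd k"
  have "(\<lambda>y. (e \<bullet> y) ^ k) \<in> borel_measurable \<sigma>"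
    by (intro measurable_continuous_sphere sigma_in continuous_intros)
  from integral_reflect[OF this, of e] have "mean (\<lambda>t. (- t) ^ k) = mean (\<lambda>t. t ^ k)"
    by (simp add: zonal_mean_def reflect_self flip: inner_reflect_left)
  then show ?thesis using k by (simp add: zonal_mean_def)
qed

text \<open>Odd powers average to 0. For even \<open>k\<close>, 1 - (e . y)^2 is the sum of (b .
  y)^2 over the DIM - 1 other basis vectors, and by \<open>mixed_moment\<close> each of them
  contributes the same amount.\<close>

lemma mean_moment_rec:
  "(real k + 1) * (mean (\<lambda>t. t ^ k) - mean (\<lambda>t. t ^ (k + 2))) = (real DIM('a) - 1) * mean (\<lambda>t. t ^ (k + 2))"
proof (cases "odd k")
  case True
  then show ?thesis using mean_odd_power[of k] mean_odd_power[of "k + 2"] by simp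
next
  case False
  then obtain j where k: "k = 2 * j" by (auto elim: evenE)
  have int: "integrable \<sigma> f" if "continuous_on UNIV f" for f :: "'a \<Rightarrow> real"
    using that by (rule integrable_continuous_sphere[OF sigma_in])
  have "mean (\<lambda>t. t ^ k) - mean (\<lambda>t. t ^ (k + 2)) = (\<integral>y. (e \<bullet> y) ^ k * (1 - (e \<bullet> y)\<^sup>2) \<partial>\<sigma>)"
    unfolding zonal_mean_def
    by (subst Bochner_Integration.integral_diff[symmetric])
      (auto intro!: int continuous_intros simp: algebra_simps power_add power2_eq_square)
  also have "\<dots> = (\<integral>y. (\<Sum>b\<in>Basis - {e}. (e \<bullet> y) ^ k * (b \<bullet> y)\<^sup>2) \<partial>\<sigma>)"
  proof (rule integral_cong_sphere_prob[OF sigma_in])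
    fix y :: 'a assume "norm y = 1"
    then have "1 = (\<Sum>b\<in>Basis. (b \<bullet> y)\<^sup>2)"
      using euclidean_inner[of y y] by (simp add: norm_eq_1 power2_eq_square inner_commute)
    also have "\<dots> = (e \<bullet> y)\<^sup>2 + (\<Sum>b\<in>Basis - {e}. (b \<bullet> y)\<^sup>2)"
      using e by (simp add: sum.remove)
    finally have "1 - (e \<bullet> y)\<^sup>2 = (\<Sum>b\<in>Basis - {e}. (b \<bullet> y)\<^sup>2)" by simp
    then show "(e \<bullet> y) ^ k * (1 - (e \<bullet> y)\<^sup>2) = (\<Sum>b\<in>Basis - {e}. (e \<bullet> y) ^ k * (b \<bullet> y)\<^sup>2)"
      by (simp only: sum_distrib_left)
  qed
  also have "\<dots> = (\<Sum>b\<in>Basis - {e}. \<integral>y. (e \<bullet> y) ^ k * (b \<bullet> y)\<^sup>2 \<partial>\<sigma>)"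
    by (intro Bochner_Integration.integral_sum int continuous_intros)
  finally have "(real k + 1) * (mean (\<lambda>t. t ^ k) - mean (\<lambda>t. t ^ (k + 2))) =
      (\<Sum>b\<in>Basis - {e}. (2 * real j + 1) * (\<integral>y. (e \<bullet> y) ^ (2 * j) * (b \<bullet> y)\<^sup>2 \<partial>\<sigma>))"
    by (simp add: k sum_distrib_left)
  also have "\<dots> = (\<Sum>b\<in>Basis - {e}. mean (\<lambda>t. t ^ (2 * j + 2)))"
    by (intro sum.cong refl mixed_moment) auto
  also have "\<dots> = (real DIM('a) - 1) * mean (\<lambda>t. t ^ (k + 2))"
    using e by (simp add: k card_Diff_singleton of_nat_diff)
  finally show ?thesis .
qed

sublocale gegenbauer_functional l "\<lambda>p. mean (poly p)"
proof
  show "0 \<le> l" using dim by (simp add: l_eq)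
  show "mean (poly (p + q)) = mean (poly p) + mean (poly q)" for p q
    using integrable_mean[of "poly p" e] integrable_mean[of "poly q" e]
    by (simp add: zonal_mean_def continuous_intros)
  show "mean (poly (smult c p)) = c * mean (poly p)" for c p
    by (simp add: zonal_mean_def)
  show "mean (poly 1) = 1"
    using mean_const[of 1] by (simp add: zonal_mean_def)
  show "mean (poly (monom 1 1)) = 0"
    using mean_odd_power[of 1] by (simp add: zonal_mean_def poly_monom)
  show "(real k + 1) * (mean (poly (monom 1 k)) - mean (poly (monom 1 (k + 2)))) =
      (2 * l + 1) * mean (poly (monom 1 (k + 2)))" for k
  proof -
    have "2 * l + 1 = real DIM('a) - 1" by (simp add: l_eq field_simps)
    then show ?thesis using mean_moment_rec[of k] by (simp only: poly_monom[abs_def] mult_1)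
  qed
qed


lemma mean_geg_norm_pos: "mean (\<lambda>t. poly (geg l n) t * poly (geg l n) t) > 0"
  using geg_norm_pos[of n] by (simp add: zonal_mean_def)

text \<open>Split \<open>z = (x \<bullet> z) x + w\<close> with \<open>w\<close> orthogonal to \<open>x\<close>: odd powers of \<open>w \<bullet> y\<close> integrate to \<open>0\<close>
  and even ones contribute powers of \<open>norm w ^ 2 = 1 - (x \<bullet> z)\<^sup>2\<close>.\<close>

lemma zonal_kernel_power:
  assumes F: "continuous_on UNIV F"
  shows "\<exists>r. degree r \<le> n \<and> (\<forall>x z :: 'a. norm x = 1 \<longrightarrow> norm z = 1 \<longrightarrow>
    (\<integral>y. F (x \<bullet> y) * (y \<bullet> z) ^ n \<partial>\<sigma>) = poly r (x \<bullet> z))"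
proof -
  obtain b :: 'a where b: "b \<in> Basis" "b \<noteq> e"
    using dim e card_le_Suc0_iff_eq[of "Basis :: 'a set"] by (metis One_nat_def Suc_1 finite_Basis not_less_eq_eq)
  then have eb: "e \<bullet> b = 0" "norm b = 1" using e by (auto simp: inner_Basis)
  \<comment> \<open>\<open>G k\<close> absorbs the power of x . y in the k-th binomial term of (y .
    z)^n, so that only (w . y)^k remains beside it.\<close>
  define G where "G k t = F t * t ^ (n - k)" for k t
  have G: "continuous_on UNIV (\<lambda>(s, t). G k s * t ^ j)" for k j
    unfolding G_def case_prod_unfold
    by (intro continuous_intros continuous_on_compose2[OF F]) auto
  have Gint: "integrable \<sigma> (\<lambda>y. G k (x \<bullet> y) * (w \<bullet> y) ^ j)" for k j and x w :: 'a
    unfolding G_def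
    by (rule integrable_continuous_sphere[OF sigma_in])
      (intro continuous_intros continuous_on_compose2[OF F], auto)
  define \<kappa> where "\<kappa> k = (\<integral>y. G k (e \<bullet> y) * (b \<bullet> y) ^ k \<partial>\<sigma>)" for k
  have \<kappa>_odd: "\<kappa> k = 0" if "odd k" for k
  proof -
    have "reflect b e = e" using eb by (intro reflect_eq_self) (simp add: inner_commute)
    then have "\<kappa> k = (\<integral>y. G k (e \<bullet> y) * (- (b \<bullet> y)) ^ k \<partial>\<sigma>)"
      using integral_reflect[OF borel_measurable_integrable[OF Gint[of k e b k]], of b]
      by (simp add: \<kappa>_def reflect_self flip: inner_reflect_left)
    then show ?thesis using that by (simp add: \<kappa>_def)
  qed
  \<comment> \<open>After scaling \<open>w\<close> to unit length, the orthonormal pair (x, w) may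
    be exchanged for (e, b); what remains depends on \<open>w\<close> only through its norm.\<close>
  have main: "(\<integral>y. G k (x \<bullet> y) * (w \<bullet> y) ^ k \<partial>\<sigma>) = (if even k then ((norm w)\<^sup>2) ^ (k div 2) * \<kappa> k else 0)"
    if x: "norm x = 1" and w: "x \<bullet> w = 0" for x w :: 'a and k
  proof (cases "w = 0")
    case True
    then show ?thesis
    proof (cases k)
      case 0
      have "continuous_on UNIV (G 0)" unfolding G_def by (intro continuous_intros F)
      then show ?thesis using mean_eq[of "G 0" x] mean_eq[of "G 0" e] x norm_e 0 by (simp add: \<kappa>_def)
    next
      case (Suc j)
      then show ?thesis using True by auto
    qed
  next
    case False
    have "(\<integral>y. G k (x \<bullet> y) * (w \<bullet> y) ^ k \<partial>\<sigma>) = (\<integral>y. norm w ^ k * (G k (x \<bullet> y) * (sgn w \<bullet> y) ^ k) \<partial>\<sigma>)"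
      using False
      by (intro Bochner_Integration.integral_cong) (auto simp: sgn_div_norm power_mult_distrib field_simps)
    also have "\<dots> = norm w ^ k * (\<integral>y. G k (x \<bullet> y) * (sgn w \<bullet> y) ^ k \<partial>\<sigma>)"
      by simp
    also have "(\<integral>y. G k (x \<bullet> y) * (sgn w \<bullet> y) ^ k \<partial>\<sigma>) = \<kappa> k"
      unfolding \<kappa>_def using False x w eb norm_e
      by (intro integral_orthonormal_pair[OF G]) (auto simp: norm_sgn sgn_div_norm)
    finally show ?thesis using \<kappa>_odd by (auto simp: power_mult[symmetric])
  qed
  \<comment> \<open>The degree stays at most n because (n - k) + 2 (k div 2) <= n, where (norm w)^2
    = 1 - (x . z)^2 has been used for even \<open>k\<close>.\<close>
  define r where "r = (\<Sum>k\<le>n. smult (real (n choose k) * (if even k then \<kappa> k else 0))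
    (monom 1 (n - k) * [:1, 0, -1:] ^ (k div 2)))"
  have "degree r \<le> n"
    unfolding r_def
  proof (intro degree_sum_le finite_atMost order_trans[OF degree_smult_le])
    fix k assume "k \<in> {..n}"
    have "degree ([:1, 0, -1 :: real:] ^ (k div 2)) \<le> 2 * (k div 2)"
      using degree_power_le[of "[:1, 0, -1 :: real:]" "k div 2"] by simp
    also have "2 * (k div 2) \<le> k" by simp
    finally show "degree (monom 1 (n - k) * [:1, 0, -1 :: real:] ^ (k div 2)) \<le> n"
      using \<open>k \<in> {..n}\<close> degree_monom_le[of "1::real" "n - k"]
        degree_mult_le[of "monom 1 (n - k)" "[:1, 0, -1 :: real:] ^ (k div 2)"] by simp
  qed
  moreover have "(\<integral>y. F (x \<bullet> y) * (y \<bullet> z) ^ n \<partial>\<sigma>) = poly r (x \<bullet> z)"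
    if x: "norm x = 1" and z: "norm z = 1" for x z :: 'a
  proof -
    define s where "s = x \<bullet> z"
    define w where "w = z - s *\<^sub>R x"
    have xw: "x \<bullet> w = 0" using x by (simp add: w_def s_def inner_diff_right norm_eq_1)
    have nw: "(norm w)\<^sup>2 = 1 - s\<^sup>2"
      unfolding power2_norm_eq_inner using x z
      by (simp add: w_def s_def inner_diff_left inner_diff_right norm_eq_1 inner_commute power2_eq_square)
    have "(\<integral>y. F (x \<bullet> y) * (y \<bullet> z) ^ n \<partial>\<sigma>) =
      (\<integral>y. (\<Sum>k\<le>n. real (n choose k) * s ^ (n - k) * (G k (x \<bullet> y) * (w \<bullet> y) ^ k)) \<partial>\<sigma>)"
    proof (intro Bochner_Integration.integral_cong refl)
      fix y
      have "y \<bullet> z = w \<bullet> y + s * (x \<bullet> y)" by (simp add: w_def inner_diff_left inner_commute[of y z] inner_commute[of y x])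
      then have "(y \<bullet> z) ^ n = (\<Sum>k\<le>n. real (n choose k) * (w \<bullet> y) ^ k * (s * (x \<bullet> y)) ^ (n - k))"
        by (simp only: binomial_ring)
      then show "F (x \<bullet> y) * (y \<bullet> z) ^ n = (\<Sum>k\<le>n. real (n choose k) * s ^ (n - k) * (G k (x \<bullet> y) * (w \<bullet> y) ^ k))"
        by (simp add: sum_distrib_left G_def power_mult_distrib algebra_simps)
    qed
    also have "\<dots> = (\<Sum>k\<le>n. real (n choose k) * s ^ (n - k) * (\<integral>y. G k (x \<bullet> y) * (w \<bullet> y) ^ k \<partial>\<sigma>))"
      by (subst Bochner_Integration.integral_sum) (auto intro!: Gint)
    also have "\<dots> = poly r s"
      unfolding r_def poly_sum main[OF x xw] nw
      by (intro sum.cong refl) (simp add: poly_monom poly_power power2_eq_square)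
    finally show ?thesis by (simp add: s_def)
  qed
  ultimately show ?thesis by blast
qed

lemma zonal_kernel_poly:
  assumes F: "continuous_on UNIV F"
  shows "\<exists>r. degree r \<le> degree p \<and> (\<forall>x z :: 'a. norm x = 1 \<longrightarrow> norm z = 1 \<longrightarrow>
    (\<integral>y. F (x \<bullet> y) * poly p (y \<bullet> z) \<partial>\<sigma>) = poly r (x \<bullet> z))"
proof -
  obtain r where r: "\<And>n. degree (r n) \<le> n" "\<And>n x z :: 'a. norm x = 1 \<Longrightarrow> norm z = 1 \<Longrightarrow>
    (\<integral>y. F (x \<bullet> y) * (y \<bullet> z) ^ n \<partial>\<sigma>) = poly (r n) (x \<bullet> z)"
    using zonal_kernel_power[OF F] by metis
  define R where "R = (\<Sum>n\<le>degree p. smult (coeff p n) (r n))"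
  have "degree R \<le> degree p"
    unfolding R_def
    by (intro degree_sum_le order_trans[OF degree_smult_le] order_trans[OF r(1)]) auto
  moreover have "(\<integral>y. F (x \<bullet> y) * poly p (y \<bullet> z) \<partial>\<sigma>) = poly R (x \<bullet> z)"
    if "norm x = 1" "norm z = 1" for x z :: 'a
  proof -
    have "integrable \<sigma> (\<lambda>y. F (x \<bullet> y) * (y \<bullet> z) ^ n)" for n
      by (rule integrable_continuous_sphere[OF sigma_in])
        (intro continuous_intros continuous_on_compose2[OF F], auto)
    then have "(\<integral>y. F (x \<bullet> y) * poly p (y \<bullet> z) \<partial>\<sigma>) =
        (\<Sum>n\<le>degree p. coeff p n * (\<integral>y. F (x \<bullet> y) * (y \<bullet> z) ^ n \<partial>\<sigma>))"
      unfolding poly_altdef sum_distrib_left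
      by (subst Bochner_Integration.integral_sum) (simp_all add: mult.left_commute[of "F _"])
    then show ?thesis by (simp add: r(2)[OF that] R_def poly_sum)
  qed
  ultimately show ?thesis by blast
qed

text \<open>The convolution operator is self-adjoint and preserves the degree of zonal polynomials,
  so it maps \<open>geg l n\<close> to a polynomial of degree at most \<open>n\<close> orthogonal to all lower degrees.\<close>

lemma Funk_Hecke:
  assumes F: "continuous_on UNIV F" and unit: "norm x = 1" "norm (z::'a) = 1"
  shows "(\<integral>y. F (x \<bullet> y) * poly (geg l n) (y \<bullet> z) \<partial>\<sigma>) =
    mean (\<lambda>t. F t * poly (geg l n) t) * poly (geg l n) (x \<bullet> z)"
proof -
  obtain r where r: "degree r \<le> degree (geg l n)" and
    r_eq: "\<And>x z :: 'a. norm x = 1 \<Longrightarrow> norm z = 1 \<Longrightarrow>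
      (\<integral>y. F (x \<bullet> y) * poly (geg l n) (y \<bullet> z) \<partial>\<sigma>) = poly r (x \<bullet> z)"
    using zonal_kernel_poly[OF F] by blast
  \<comment> \<open>Self-adjointness: Fubini shifts the convolution from \<open>geg l n\<close> to
    \<open>q\<close>, giving a polynomial of degree at most that of \<open>q\<close>, to which
    \<open>geg l n\<close> is orthogonal.\<close>
  have "mean (poly (q * r)) = 0" if q: "degree q < n" for q
  proof -
    obtain r' where r': "degree r' \<le> degree q" and
      r'_eq: "\<And>x z :: 'a. norm x = 1 \<Longrightarrow> norm z = 1 \<Longrightarrow>
        (\<integral>y. F (x \<bullet> y) * poly q (y \<bullet> z) \<partial>\<sigma>) = poly r' (x \<bullet> z)"
      using zonal_kernel_poly[OF F] by blast
    have c: "continuous_on UNIV (\<lambda>(y, x :: 'a). poly q (e \<bullet> x) * (F (x \<bullet> y) * poly (geg l n) (y \<bullet> e)))"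
      unfolding case_prod_unfold
      by (intro continuous_intros continuous_on_compose2[OF F]) auto
    have "mean (poly (q * r)) = (\<integral>x. (\<integral>y. poly q (e \<bullet> x) * (F (x \<bullet> y) * poly (geg l n) (y \<bullet> e)) \<partial>\<sigma>) \<partial>\<sigma>)"
      unfolding zonal_mean_def
      by (intro integral_cong_sphere_prob[OF sigma_in]) (simp add: r_eq norm_e inner_commute)
    also have "\<dots> = (\<integral>y. (\<integral>x. poly q (e \<bullet> x) * (F (x \<bullet> y) * poly (geg l n) (y \<bullet> e)) \<partial>\<sigma>) \<partial>\<sigma>)"
      by (rule integral_swap_continuous[OF sigma_in sigma_in c])
    also have "\<dots> = (\<integral>y. poly (r' * geg l n) (e \<bullet> y) \<partial>\<sigma>)"
    proof (rule integral_cong_sphere_prob[OF sigma_in])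
      fix y :: 'a assume y: "norm y = 1"
      have "(\<integral>x. poly q (e \<bullet> x) * (F (x \<bullet> y) * poly (geg l n) (y \<bullet> e)) \<partial>\<sigma>) =
          poly (geg l n) (y \<bullet> e) * (\<integral>x. F (y \<bullet> x) * poly q (x \<bullet> e) \<partial>\<sigma>)"
        by (subst Bochner_Integration.integral_mult_right_zero[symmetric])
          (simp add: mult_ac inner_commute)
      then show "(\<integral>x. poly q (e \<bullet> x) * (F (x \<bullet> y) * poly (geg l n) (y \<bullet> e)) \<partial>\<sigma>) =
          poly (r' * geg l n) (e \<bullet> y)"
        using r'_eq[OF y norm_e] by (simp add: inner_commute)
    qed
    also have "\<dots> = 0"
      using geg_orthogonal[of r' n] r' q by (simp add: zonal_mean_def)
    finally show ?thesis .
  qed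
  then have "r = smult (poly r 1) (geg l n)"
    using r degree_coeff_geg[OF l] by (intro orthogonal_imp_multiple_geg) auto
  \<comment> \<open>The eigenvalue is read off at x = z = e, where x . z = 1.\<close>
  moreover have "poly r 1 = mean (\<lambda>t. F t * poly (geg l n) t)"
    using r_eq[OF norm_e norm_e] e by (simp add: zonal_mean_def inner_commute)
  ultimately show ?thesis
    using r_eq[OF unit] by (metis poly_smult)
qed

end

subsection \<open>Energies of zonal kernels\<close>

text \<open>Uniform continuity covers small distances; beyond d the bound 2 B is at most 2 B (dist /
  d)^2. A quadratic error is wanted because dist^2 = 2 (1 - x . y) on the sphere, which a peak
  kernel averages to something small.\<close>

lemma quadratic_modulus:
  fixes f :: "'a::metric_space \<Rightarrow> real"
  assumes S: "compact S" and f: "continuous_on S f" and \<epsilon>: "\<epsilon> > 0"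
  obtains C where "C \<ge> 0" "\<And>x y. x \<in> S \<Longrightarrow> y \<in> S \<Longrightarrow> \<bar>f x - f y\<bar> \<le> \<epsilon> + C * (dist x y)\<^sup>2"
proof -
  obtain B where B: "B > 0" "\<And>x. x \<in> S \<Longrightarrow> \<bar>f x\<bar> \<le> B"
    using compact_imp_bounded[OF compact_continuous_image[OF f S]] unfolding bounded_pos by auto
  obtain d where d: "d > 0" "\<And>x y. x \<in> S \<Longrightarrow> y \<in> S \<Longrightarrow> dist y x < d \<Longrightarrow> dist (f y) (f x) < \<epsilon>"
    using compact_uniformly_continuous[OF f S] \<epsilon> unfolding uniformly_continuous_on_def by blast
  have "\<bar>f x - f y\<bar> \<le> \<epsilon> + 2 * B / d\<^sup>2 * (dist x y)\<^sup>2" if xy: "x \<in> S" "y \<in> S" for x y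
  proof (cases "dist x y < d")
    case True
    then have "\<bar>f x - f y\<bar> < \<epsilon>"
      using d(2)[of y x] xy by (simp add: dist_real_def)
    moreover have "0 \<le> 2 * B / d\<^sup>2 * (dist x y)\<^sup>2" using B(1) by simp
    ultimately show ?thesis by linarith
  next
    case False
    then have "d\<^sup>2 \<le> (dist x y)\<^sup>2" using d(1) by (intro power_mono) auto
    then have "2 * B \<le> 2 * B / d\<^sup>2 * (dist x y)\<^sup>2"
      using B(1) d(1) by (simp add: field_simps)
    then show ?thesis using B(2)[OF xy(1)] B(2)[OF xy(2)] \<epsilon> by linarith
  qed
  then show ?thesis using that[of "2 * B / d\<^sup>2"] B(1) by simp
qed

lemma dist_square_unit: "\<lbrakk>norm x = 1; norm y = 1\<rbrakk> \<Longrightarrow> (dist x y)\<^sup>2 = 2 * (1 - x \<bullet> y)"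
  unfolding dist_norm power2_norm_eq_inner
  by (simp add: inner_diff_left inner_diff_right norm_eq_1 inner_commute)

lemma continuous_on_real_comp:
  fixes F :: "real \<Rightarrow> real"
  shows "continuous_on UNIV F \<Longrightarrow> continuous_on S f \<Longrightarrow> continuous_on S (\<lambda>x. F (f x))"
  by (rule continuous_on_compose2) auto

lemma energy_cong:
  assumes "\<mu> \<in> sphere_prob_measures" "\<And>t. \<bar>t\<bar> \<le> 1 \<Longrightarrow> F t = G t"
  shows "energy F \<mu> = energy G \<mu>"
  unfolding energy_def by (intro integral_cong_sphere_prob assms abs_inner_unit_le)

lemma energy_bound:
  assumes "\<mu> \<in> sphere_prob_measures" "\<And>x y :: 'a::euclidean_space. norm x = 1 \<Longrightarrow> norm y = 1 \<Longrightarrow> \<bar>F (x \<bullet> y)\<bar> \<le> B"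
  shows "\<bar>energy F (\<mu> :: 'a measure)\<bar> \<le> B"
  unfolding energy_def by (intro abs_integral_sphere_prob_le assms)

context
  fixes \<mu> :: "'a::euclidean_space measure"
  assumes \<mu>: "\<mu> \<in> sphere_prob_measures"
begin

lemma energy_add:
  assumes F: "continuous_on UNIV F" and G: "continuous_on UNIV G"
  shows "energy (\<lambda>t. F t + G t) \<mu> = energy F \<mu> + energy G \<mu>"
proof -
  have c: "continuous_on UNIV (\<lambda>(y, x :: 'a). H (x \<bullet> y))" if "continuous_on UNIV H" for H :: "real \<Rightarrow> real"
    unfolding case_prod_unfold by (intro continuous_on_real_comp[OF that] continuous_intros)
  have i: "integrable \<mu> (\<lambda>x. H (x \<bullet> y))" if "continuous_on UNIV H" for H :: "real \<Rightarrow> real" and y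
    by (rule integrable_continuous_sphere[OF \<mu>]) (intro continuous_on_real_comp[OF that] continuous_intros)
  show ?thesis
    unfolding energy_def using F G
    by (simp add: i integrable_inner_integral[OF \<mu> \<mu> c])
qed

lemma energy_cmult: "energy (\<lambda>t. c * F t) \<mu> = c * energy F \<mu>"
  unfolding energy_def by simp

lemma energy_const: "energy (\<lambda>_. c) \<mu> = c"
  unfolding energy_def using prob_space.prob_space[OF prob_space_sphere_prob[OF \<mu>]] by simp

lemma energy_sum:
  assumes "\<And>i. i \<in> I \<Longrightarrow> continuous_on UNIV (F i)"
  shows "energy (\<lambda>t. \<Sum>i\<in>I. F i t) \<mu> = (\<Sum>i\<in>I. energy (F i) \<mu>)"
  using assms
proof (induction I rule: infinite_finite_induct)
  case (insert i I)
  have "energy (\<lambda>t. F i t + (\<Sum>i\<in>I. F i t)) \<mu> = energy (F i) \<mu> + energy (\<lambda>t. \<Sum>i\<in>I. F i t) \<mu>"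
    using insert by (intro energy_add continuous_intros) auto
  then show ?case using insert by simp
qed (simp_all add: energy_const)

end

section \<open>Coefficients and energies of the polynomials \<open>P n\<close>\<close>

context zonal
begin

abbreviation P :: "nat \<Rightarrow> real \<Rightarrow> real" where "P n \<equiv> poly (geg l n)"

definition coef :: "(real \<Rightarrow> real) \<Rightarrow> nat \<Rightarrow> real" where
  "coef F n = mean (\<lambda>t. F t * P n t)"

text \<open>The squared norm of \<open>P n\<close>, and by Funk-Hecke also the factor in its
  self-convolution: \<open>P n\<close> convolved with itself is \<open>geg_sq n\<close> times
  \<open>P n\<close>.\<close>

definition geg_sq :: "nat \<Rightarrow> real" where "geg_sq n = coef (P n) n"

lemma geg_sq_pos: "geg_sq n > 0"
  using mean_geg_norm_pos by (simp add: geg_sq_def coef_def)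

lemma coef_geg: "coef (P m) n = (if m = n then geg_sq n else 0)"
proof -
  have "mean (poly (geg l m * geg l n)) = 0" if "m \<noteq> n"
    using that geg_orthogonal[of "geg l m" n] geg_orthogonal[of "geg l n" m] degree_coeff_geg[OF l]
    by (cases m n rule: linorder_cases) (auto simp: mult.commute)
  then show ?thesis by (auto simp: geg_sq_def coef_def zonal_mean_def)
qed

lemma mean_add:
  assumes "continuous_on UNIV F" "continuous_on UNIV G"
  shows "mean (\<lambda>t. F t + G t) = mean F + mean G"
  unfolding zonal_mean_def using assms by (simp add: integrable_mean)

lemma mean_cmult: "mean (\<lambda>t. c * F t) = c * mean F"
  by (simp add: zonal_mean_def)

lemma mean_sum:
  assumes "\<And>i. i \<in> I \<Longrightarrow> continuous_on UNIV (F i)"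
  shows "mean (\<lambda>t. \<Sum>i\<in>I. F i t) = (\<Sum>i\<in>I. mean (F i))"
  unfolding zonal_mean_def using assms by (intro Bochner_Integration.integral_sum integrable_mean)

lemma mean_mono:
  assumes "continuous_on UNIV F" "continuous_on UNIV G" "\<And>t. \<bar>t\<bar> \<le> 1 \<Longrightarrow> F t \<le> G t"
  shows "mean F \<le> mean G"
  unfolding zonal_mean_def using assms
  by (intro integral_mono integrable_mean)
    (auto simp: space_sphere_prob[OF sigma_in] intro!: abs_inner_unit_le norm_e)

lemma mean_mult_commute_inner:
  "continuous_on UNIV F \<Longrightarrow> norm y = 1 \<Longrightarrow> (\<integral>x. F (x \<bullet> y) \<partial>\<sigma>) = mean F" for y :: 'a
  using mean_eq[of F y] by (simp add: inner_commute)

lemma energy_sigma: "continuous_on UNIV F \<Longrightarrow> energy F (\<sigma> :: 'a measure) = mean F"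
proof -
  assume "continuous_on UNIV F"
  then have "energy F (\<sigma> :: 'a measure) = (\<integral>y. mean F \<partial>(\<sigma> :: 'a measure))"
    unfolding energy_def by (intro integral_cong_sphere_prob[OF sigma_in] mean_mult_commute_inner)
  then show ?thesis using prob_space.prob_space[OF prob_space_sigma[where 'a = 'a]] by simp
qed

lemma coef_sum_geg:
  assumes "\<And>t. q t = (\<Sum>m\<le>N. a m * P m t)" "n \<le> N"
  shows "coef q n = a n * geg_sq n"
proof -
  have "coef q n = mean (\<lambda>t. \<Sum>m\<le>N. a m * (P m t * P n t))"
    unfolding coef_def assms(1) by (simp add: sum_distrib_right mult.assoc)
  also have "\<dots> = (\<Sum>m\<le>N. a m * coef (P m) n)"
    by (subst mean_sum) (auto simp: mean_cmult coef_def intro!: continuous_intros)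
  also have "\<dots> = (\<Sum>m\<le>N. if m = n then a n * geg_sq n else 0)"
    by (intro sum.cong) (auto simp: coef_geg)
  finally show ?thesis using assms(2) by simp
qed

lemma Funk_Hecke_coef:
  "\<lbrakk>continuous_on UNIV F; norm x = 1; norm z = 1\<rbrakk> \<Longrightarrow>
    (\<integral>y. F (x \<bullet> y) * P n (y \<bullet> z) \<partial>\<sigma>) = coef F n * P n (x \<bullet> z)" for x z :: 'a
  unfolding coef_def by (rule Funk_Hecke)

text \<open>The reproducing property of \<open>P n\<close> turns its energy into a mean square.\<close>

lemma
  fixes \<mu> :: "'a measure"
  assumes \<mu>: "\<mu> \<in> sphere_prob_measures"
  shows energy_geg: "geg_sq n * energy (P n) \<mu> = (\<integral>z. (\<integral>x. P n (x \<bullet> z) \<partial>\<mu>)\<^sup>2 \<partial>\<sigma>)"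
    and integrable_potential_square: "integrable \<sigma> (\<lambda>z. (\<integral>x. P n (x \<bullet> z) \<partial>\<mu>)\<^sup>2)"
proof -
  define H where "H z = (\<integral>x. P n (x \<bullet> z) \<partial>\<mu>)" for z
  have c: "continuous_on UNIV (\<lambda>(x, z :: 'a). P n (x \<bullet> z))"
    and c': "continuous_on UNIV (\<lambda>(z, x :: 'a). P n (x \<bullet> z))"
    unfolding case_prod_unfold by (intro continuous_intros)+
  obtain B where B: "\<And>x z :: 'a. norm x = 1 \<Longrightarrow> norm z = 1 \<Longrightarrow> \<bar>P n (x \<bullet> z)\<bar> \<le> B"
    using bounded_pair_continuous[OF c] by blast
  have H: "H \<in> borel_measurable \<sigma>"
    unfolding H_def by (rule measurable_inner_integral[OF sigma_in \<mu> c'])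
  have HB: "\<bar>H z\<bar> \<le> B" if "norm z = 1" for z
    unfolding H_def by (intro abs_integral_sphere_prob_le[OF \<mu>] B that)
  have "integrable \<sigma> (\<lambda>z. (H z)\<^sup>2)"
    using H HB by (intro integrable_sphere_prob[OF sigma_in, where B = "B\<^sup>2"]) (auto simp: abs_le_square_iff[symmetric] intro: order_trans[OF _ abs_ge_self])
  then show "integrable \<sigma> (\<lambda>z. (\<integral>x. P n (x \<bullet> z) \<partial>\<mu>)\<^sup>2)" by (simp add: H_def)
  have "geg_sq n * energy (P n) \<mu> = (\<integral>y. (\<integral>x. (\<integral>z. P n (x \<bullet> z) * P n (z \<bullet> y) \<partial>\<sigma>) \<partial>\<mu>) \<partial>\<mu>)"
  proof -
    have "(\<integral>y. (\<integral>x. (\<integral>z. P n (x \<bullet> z) * P n (z \<bullet> y) \<partial>\<sigma>) \<partial>\<mu>) \<partial>\<mu>) =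
        (\<integral>y. (\<integral>x. geg_sq n * P n (x \<bullet> y) \<partial>\<mu>) \<partial>\<mu>)"
      unfolding geg_sq_def by (intro integral_cong_sphere_prob[OF \<mu>] Funk_Hecke_coef continuous_intros)
    then show ?thesis by (simp add: energy_def)
  qed
  also have "\<dots> = (\<integral>y. (\<integral>z. (\<integral>x. P n (x \<bullet> z) * P n (z \<bullet> y) \<partial>\<mu>) \<partial>\<sigma>) \<partial>\<mu>)"
    by (intro Bochner_Integration.integral_cong refl integral_swap_continuous[OF sigma_in \<mu>])
      (auto simp: case_prod_unfold intro!: continuous_intros)
  also have "\<dots> = (\<integral>y. (\<integral>z. H z * P n (z \<bullet> y) \<partial>\<sigma>) \<partial>\<mu>)"
    by (simp add: H_def)
  \<comment> \<open>\<open>H\<close> is known here as a bounded measurable function, hence the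
    bounded form of Fubini.\<close>
  also have "\<dots> = (\<integral>z. (\<integral>y. H z * P n (z \<bullet> y) \<partial>\<mu>) \<partial>\<sigma>)"
  proof (rule integral_swap_sphere_prob[OF sigma_in \<mu>, where B = "B * B"])
    show "(\<lambda>(z, y). H z * P n (z \<bullet> y)) \<in> borel_measurable (\<sigma> \<Otimes>\<^sub>M \<mu>)"
      using measurable_pair_continuous[OF c sigma_in \<mu>] measurable_compose[OF measurable_fst H]
      unfolding case_prod_unfold by (intro borel_measurable_times) auto
    show "\<bar>H z * P n (z \<bullet> y)\<bar> \<le> B * B" if "norm z = 1" "norm y = 1" for z y
      unfolding abs_mult using HB[OF that(1)] B[OF that] by (intro mult_mono) auto
  qed
  also have "\<dots> = (\<integral>z. (H z)\<^sup>2 \<partial>\<sigma>)"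
    by (simp add: H_def inner_commute power2_eq_square)
  finally show "geg_sq n * energy (P n) \<mu> = (\<integral>z. (\<integral>x. P n (x \<bullet> z) \<partial>\<mu>)\<^sup>2 \<partial>\<sigma>)"
    by (simp add: H_def)
qed

lemma energy_geg_nonneg:
  fixes \<mu> :: "'a measure"
  assumes "\<mu> \<in> sphere_prob_measures"
  shows "energy (P n) \<mu> \<ge> 0"
proof -
  have "0 \<le> geg_sq n * energy (P n) \<mu>" unfolding energy_geg[OF assms] by simp
  then show ?thesis using geg_sq_pos[of n] by (simp add: zero_le_mult_iff)
qed

subsection \<open>Approximation by polynomial kernels\<close>

text \<open>The kernel \<open>(1 + t) ^ k\<close>, normalised. Partial integration shows that it concentrates at \<open>t = 1\<close>.\<close>

lemma obtain_peak_kernel: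
  assumes "\<eta> > 0"
  obtains q where "\<And>t. \<bar>t\<bar> \<le> 1 \<Longrightarrow> poly q t \<ge> 0" "mean (poly q) = 1"
    "mean (\<lambda>t. poly q t * (1 - t)) \<le> \<eta>"
proof -
  \<comment> \<open>Makes the factor (2 l + 1) / (n + 1) from partial integration at most
    \<open>\<eta>\<close>.\<close>
  obtain n :: nat where n: "(2 * l + 1) / \<eta> \<le> real n" using real_arch_simple by blast
  define Q :: "real poly" where "Q = [:1, 1:] ^ Suc n"
  have Qt: "poly Q t = (1 + t) ^ Suc n" for t by (simp add: Q_def poly_power distrib_right)
  \<comment> \<open>By Bernoulli (1 + t)^(n+1) >= 1 + (n + 1) t, whose mean is 1. So the mean of
    \<open>Q\<close> is at least 1 and may be divided by.\<close>
  have "mean (\<lambda>t. 1 + real (Suc n) * t) = 1"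
    using mean_odd_power[of 1]
    by (subst mean_add) (auto simp: mean_const mean_cmult intro!: continuous_intros)
  moreover have "mean (\<lambda>t. 1 + real (Suc n) * t) \<le> mean (poly Q)"
    unfolding Qt[abs_def]
    by (intro mean_mono continuous_intros) (auto intro!: Bernoulli_inequality simp del: power_Suc of_nat_Suc)
  ultimately have Q1: "mean (poly Q) \<ge> 1" by simp
  have "[:1, 0, -1:] * pderiv Q = smult (real (Suc n)) ([:1, -1:] * Q)"
    unfolding Q_def pderiv_power_Suc
    by (rule poly_ext) (simp add: pderiv_pCons poly_power algebra_simps)
  then have "real (Suc n) * mean (poly ([:1, -1:] * Q)) = (2 * l + 1) * mean (poly ([:0, 1:] * Q))"
    using by_parts[of Q] by (simp only: smult)
  moreover have "poly ([:1, -1:] * Q) = (\<lambda>t. poly Q t * (1 - t))" "poly ([:0, 1:] * Q) = (\<lambda>t. poly Q t * t)"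
    by (auto simp: algebra_simps)
  ultimately have "real (Suc n) * mean (\<lambda>t. poly Q t * (1 - t)) = (2 * l + 1) * mean (\<lambda>t. poly Q t * t)"
    by (simp only:)
  also have "\<dots> \<le> (2 * l + 1) * mean (poly Q)"
    using l by (intro mult_left_mono mean_mono continuous_intros) (auto simp: Qt abs_le_iff intro!: mult_left_le)
  also have "\<dots> \<le> real (Suc n) * \<eta> * mean (poly Q)"
    using n assms Q1 by (intro mult_right_mono) (auto simp: field_simps)
  finally have *: "mean (\<lambda>t. poly Q t * (1 - t)) \<le> \<eta> * mean (poly Q)"
    by (simp add: mult.assoc del: of_nat_Suc)
  show ?thesis
  proof (rule that)
    let ?q = "smult (1 / mean (poly Q)) Q"
    show "poly ?q t \<ge> 0" if "\<bar>t\<bar> \<le> 1" for t using that Q1 by (simp add: Qt)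
    show "mean (poly ?q) = 1" using Q1 by (simp add: smult)
    have "mean (\<lambda>t. poly ?q t * (1 - t)) = 1 / mean (poly Q) * mean (\<lambda>t. poly Q t * (1 - t))"
      by (subst mean_cmult[symmetric]) (simp add: mult.assoc)
    also have "\<dots> \<le> \<eta>"
      using divide_right_mono[OF *, of "mean (poly Q)"] Q1 by simp
    finally show "mean (\<lambda>t. poly ?q t * (1 - t)) \<le> \<eta>" .
  qed
qed

text \<open>q(x . z) is a probability density in \<open>z\<close>, so the error is an average of
  \<open>\<phi> z - a\<close>. The reference value \<open>a\<close> is free because it is taken both
  from \<open>\<phi>\<close> itself and from a different kernel that \<open>\<phi>\<close>
  approximates.\<close>

lemma peak_kernel_approx:
  fixes \<phi> :: "'a \<Rightarrow> real"
  assumes q: "\<And>t. \<bar>t\<bar> \<le> 1 \<Longrightarrow> poly q t \<ge> 0" "mean (poly q) = 1"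
    and \<phi>: "continuous_on UNIV \<phi>" and x: "norm x = 1"
    and bound: "\<And>z. norm z = 1 \<Longrightarrow> \<bar>\<phi> z - a\<bar> \<le> \<epsilon> + C * (1 - x \<bullet> z)"
  shows "\<bar>(\<integral>z. poly q (x \<bullet> z) * \<phi> z \<partial>\<sigma>) - a\<bar> \<le> \<epsilon> + C * mean (\<lambda>t. poly q t * (1 - t))"
proof -
  have int: "integrable \<sigma> f" if "continuous_on UNIV f" for f :: "'a \<Rightarrow> real"
    using that by (rule integrable_continuous_sphere[OF sigma_in])
  have q1: "(\<integral>z. poly q (x \<bullet> z) \<partial>\<sigma>) = 1"
    using mean_eq[of "poly q" x] x q(2) by (simp add: continuous_intros)
  have "(\<integral>z. poly q (x \<bullet> z) * \<phi> z \<partial>\<sigma>) - a = (\<integral>z. poly q (x \<bullet> z) * (\<phi> z - a) \<partial>\<sigma>)"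
    using q1 by (simp add: right_diff_distrib int continuous_intros \<phi>)
  also have "\<bar>\<dots>\<bar> \<le> (\<integral>z. \<bar>poly q (x \<bullet> z) * (\<phi> z - a)\<bar> \<partial>\<sigma>)"
    by (rule integral_abs_bound)
  also have "\<dots> \<le> (\<integral>z. poly q (x \<bullet> z) * (\<epsilon> + C * (1 - x \<bullet> z)) \<partial>\<sigma>)"
  proof (rule integral_mono)
    fix z :: 'a assume "z \<in> space \<sigma>"
    then have z: "norm z = 1" by (simp add: space_sphere_prob[OF sigma_in])
    show "\<bar>poly q (x \<bullet> z) * (\<phi> z - a)\<bar> \<le> poly q (x \<bullet> z) * (\<epsilon> + C * (1 - x \<bullet> z))"
      using q(1)[OF abs_inner_unit_le[OF x z]] bound[OF z] by (simp add: abs_mult mult_left_mono)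
  qed (auto intro!: int continuous_intros \<phi>)
  also have "\<dots> = (\<integral>z. \<epsilon> * poly q (x \<bullet> z) + C * (poly q (x \<bullet> z) * (1 - x \<bullet> z)) \<partial>\<sigma>)"
    by (simp add: algebra_simps)
  also have "\<dots> = \<epsilon> * (\<integral>z. poly q (x \<bullet> z) \<partial>\<sigma>) + C * (\<integral>z. poly q (x \<bullet> z) * (1 - x \<bullet> z) \<partial>\<sigma>)"
    by (subst Bochner_Integration.integral_add) (auto intro!: int continuous_intros)
  also have "(\<integral>z. poly q (x \<bullet> z) * (1 - x \<bullet> z) \<partial>\<sigma>) = mean (\<lambda>t. poly q t * (1 - t))"
    by (intro mean_eq[of "\<lambda>t. poly q t * (1 - t)"] continuous_intros x)
  finally show ?thesis by (simp add: q1)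
qed

lemma Funk_Hecke_sum:
  fixes x z :: 'a
  assumes F: "continuous_on UNIV F" and unit: "norm x = 1" "norm z = 1"
  shows "(\<integral>y. F (x \<bullet> y) * (\<Sum>m\<le>N. a m * P m (y \<bullet> z)) \<partial>\<sigma>) = (\<Sum>m\<le>N. a m * coef F m * P m (x \<bullet> z))"
proof -
  have "integrable \<sigma> (\<lambda>y. F (x \<bullet> y) * P m (y \<bullet> z))" for m
    by (rule integrable_continuous_sphere[OF sigma_in])
      (intro continuous_intros continuous_on_real_comp[OF F])
  then have "(\<integral>y. F (x \<bullet> y) * (\<Sum>m\<le>N. a m * P m (y \<bullet> z)) \<partial>\<sigma>) =
      (\<Sum>m\<le>N. a m * (\<integral>y. F (x \<bullet> y) * P m (y \<bullet> z) \<partial>\<sigma>))"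
    unfolding sum_distrib_left
    by (subst Bochner_Integration.integral_sum) (simp_all add: mult.left_commute[of "F _"])
  then show ?thesis by (simp add: Funk_Hecke_coef[OF F unit] mult.assoc)
qed

text \<open>For unit \<open>z\<close>, |x . z - y . z| <= |x - y|, so the modulus of F on [-1,1]
  carries over uniformly in \<open>z\<close>; |x - y|^2 = 2 (1 - x . y) doubles the
  constant.\<close>

lemma kernel_modulus:
  assumes F: "continuous_on UNIV F" and "\<epsilon> > 0"
  obtains C where "C \<ge> 0" "\<And>x y z :: 'a. norm x = 1 \<Longrightarrow> norm y = 1 \<Longrightarrow> norm z = 1 \<Longrightarrow>
    \<bar>F (x \<bullet> z) - F (y \<bullet> z)\<bar> \<le> \<epsilon> + C * (1 - x \<bullet> y)"
proof -
  obtain C where C: "C \<ge> 0" "\<And>s t. s \<in> {-1..1} \<Longrightarrow> t \<in> {-1..1} \<Longrightarrow> \<bar>F s - F t\<bar> \<le> \<epsilon> + C * (dist s t)\<^sup>2"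
    using quadratic_modulus[of "{-1..1}" F \<epsilon>] continuous_on_subset[OF F] assms(2) by auto
  have "\<bar>F (x \<bullet> z) - F (y \<bullet> z)\<bar> \<le> \<epsilon> + 2 * C * (1 - x \<bullet> y)"
    if unit: "norm x = 1" "norm y = 1" "norm z = 1" for x y z :: 'a
  proof -
    have "\<bar>F (x \<bullet> z) - F (y \<bullet> z)\<bar> \<le> \<epsilon> + C * (dist (x \<bullet> z) (y \<bullet> z))\<^sup>2"
      using abs_inner_unit_le[of x z] abs_inner_unit_le[of y z] unit by (intro C(2)) (auto simp: abs_le_iff)
    moreover have "dist (x \<bullet> z) (y \<bullet> z) \<le> dist x y"
      using Cauchy_Schwarz_ineq2[of "x - y" z] unit by (simp add: dist_norm inner_diff_left)
    then have "(dist (x \<bullet> z) (y \<bullet> z))\<^sup>2 \<le> 2 * (1 - x \<bullet> y)"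
      using dist_square_unit[of x y] unit power_mono[of "dist (x \<bullet> z) (y \<bullet> z)" "dist x y" 2] by simp
    from mult_left_mono[OF this C(1)]
    have "C * (dist (x \<bullet> z) (y \<bullet> z))\<^sup>2 \<le> 2 * C * (1 - x \<bullet> y)" by (simp add: mult.assoc mult.left_commute)
    ultimately show ?thesis by linarith
  qed
  then show ?thesis using C(1) by (intro that[of "2 * C"]) auto
qed

text \<open>The approximation is the convolution \<open>q * F * q\<close> with a peak kernel \<open>q\<close>, whose
  coefficients have the signs of those of \<open>F\<close>.\<close>

lemma approx_by_geg_sum:
  assumes F: "continuous_on UNIV F" and "\<epsilon> > 0"
  obtains N a where "\<And>x y :: 'a. norm x = 1 \<Longrightarrow> norm y = 1 \<Longrightarrow>
    \<bar>(\<Sum>m\<le>N. (a m)\<^sup>2 * geg_sq m * coef F m * P m (x \<bullet> y)) - F (x \<bullet> y)\<bar> \<le> \<epsilon>"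
proof -
  \<comment> \<open>Four errors of \<epsilon>/4: the modulus and C times the kernel mean, once for
    each of the two smoothings. The later denominator C + 1 keeps the choice of \<open>q\<close>
    valid for C = 0.\<close>
  obtain C where C: "C \<ge> 0" "\<And>x y z :: 'a. norm x = 1 \<Longrightarrow> norm y = 1 \<Longrightarrow> norm z = 1 \<Longrightarrow>
    \<bar>F (x \<bullet> z) - F (y \<bullet> z)\<bar> \<le> \<epsilon> / 4 + C * (1 - x \<bullet> y)"
    using kernel_modulus[OF F, of "\<epsilon> / 4"] assms(2) by auto
  obtain q where q: "\<And>t. \<bar>t\<bar> \<le> 1 \<Longrightarrow> poly q t \<ge> 0" "mean (poly q) = 1"
    and q_peak: "mean (\<lambda>t. poly q t * (1 - t)) \<le> \<epsilon> / (4 * (C + 1))"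
    using obtain_peak_kernel[of "\<epsilon> / (4 * (C + 1))"] assms(2) C(1) by auto
  define \<eta> where "\<eta> = mean (\<lambda>t. poly q t * (1 - t))"
  have \<eta>: "C * \<eta> \<le> \<epsilon> / 4"
  proof -
    have "C * \<eta> \<le> C * (\<epsilon> / (4 * (C + 1)))"
      unfolding \<eta>_def by (intro mult_left_mono q_peak C(1))
    also have "\<dots> \<le> \<epsilon> / 4" using C(1) assms(2) by (simp add: field_simps)
    finally show ?thesis .
  qed
  obtain a where "q = (\<Sum>m\<le>degree q. smult (a m) (geg l m))"
    using geg_expansion[OF l order_refl] by blast
  from arg_cong[OF this, of poly] have qa: "poly q t = (\<Sum>m\<le>degree q. a m * P m t)" for t
    by (simp add: poly_sum)
  define G where "G t = (\<Sum>m\<le>degree q. a m * coef F m * P m t)" for t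
  have G_cont: "continuous_on UNIV G" unfolding G_def by (intro continuous_intros)
  have conv1: "(\<integral>w. poly q (y \<bullet> w) * F (z \<bullet> w) \<partial>\<sigma>) = G (z \<bullet> y)"
    if "norm z = 1" "norm y = 1" for z y :: 'a
    using Funk_Hecke_sum[OF F that, of a "degree q"]
    by (simp add: qa G_def inner_commute mult.commute)
  \<comment> \<open>The first smoothing contributes \<open>a m\<close>, the second the coefficient
    \<open>a m * geg_sq m\<close> of \<open>q\<close>. Their product is nonnegative whatever the
    sign of \<open>a m\<close>.\<close>
  have conv2: "(\<integral>z. poly q (x \<bullet> z) * G (z \<bullet> y) \<partial>\<sigma>) = (\<Sum>m\<le>degree q. (a m)\<^sup>2 * geg_sq m * coef F m * P m (x \<bullet> y))"
    if "norm x = 1" "norm y = 1" for x y :: 'a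
    unfolding G_def using coef_sum_geg[OF qa]
    by (subst Funk_Hecke_sum[OF _ that]) (auto simp: power2_eq_square continuous_intros intro!: sum.cong)
  have approx1: "\<bar>G (z \<bullet> y) - F (z \<bullet> y)\<bar> \<le> \<epsilon> / 4 + C * \<eta>" if zy: "norm z = 1" "norm y = 1" for z y :: 'a
    unfolding conv1[OF zy, symmetric] \<eta>_def
  proof (rule peak_kernel_approx[OF q])
    show "\<bar>F (z \<bullet> w) - F (z \<bullet> y)\<bar> \<le> \<epsilon> / 4 + C * (1 - y \<bullet> w)" if "norm w = 1" for w
      using C(2)[OF that zy(2) zy(1)] by (simp add: inner_commute)
  qed (auto intro!: continuous_on_real_comp[OF F] continuous_intros simp: zy)
  show ?thesis
  proof (rule that)
    fix x y :: 'a assume xy: "norm x = 1" "norm y = 1"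
    have "\<bar>(\<integral>z. poly q (x \<bullet> z) * G (z \<bullet> y) \<partial>\<sigma>) - F (x \<bullet> y)\<bar> \<le> (\<epsilon> / 4 + C * \<eta> + \<epsilon> / 4) + C * \<eta>"
      unfolding \<eta>_def
    proof (rule peak_kernel_approx[OF q])
      fix z :: 'a assume z: "norm z = 1"
      show "\<bar>G (z \<bullet> y) - F (x \<bullet> y)\<bar> \<le> \<epsilon> / 4 + C * mean (\<lambda>t. poly q t * (1 - t)) + \<epsilon> / 4 + C * (1 - x \<bullet> z)"
        using approx1[OF z xy(2)] C(2)[OF xy(1) z xy(2)] unfolding \<eta>_def by linarith
    qed (auto intro!: continuous_on_real_comp[OF G_cont] continuous_intros simp: xy)
    then show "\<bar>(\<Sum>m\<le>degree q. (a m)\<^sup>2 * geg_sq m * coef F m * P m (x \<bullet> y)) - F (x \<bullet> y)\<bar> \<le> \<epsilon>"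
      unfolding conv2[OF xy] using \<eta> by linarith
  qed
qed

text \<open>Up to \<epsilon> the energy equals that of a finite combination of the
  \<open>P m\<close> with nonnegative coefficients, each \<open>P m\<close> having nonnegative
  energy.\<close>

lemma energy_nonneg:
  fixes \<mu> :: "'a measure"
  assumes \<mu>: "\<mu> \<in> sphere_prob_measures" and F: "continuous_on UNIV F" and c: "\<And>n. coef F n \<ge> 0"
  shows "energy F \<mu> \<ge> 0"
proof (rule field_le_epsilon)
  fix \<epsilon> :: real assume \<epsilon>: "\<epsilon> > 0"
  obtain a N where a: "\<And>x y :: 'a. norm x = 1 \<Longrightarrow> norm y = 1 \<Longrightarrow>
    \<bar>(\<Sum>m\<le>N. (a m)\<^sup>2 * geg_sq m * coef F m * P m (x \<bullet> y)) - F (x \<bullet> y)\<bar> \<le> \<epsilon>"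
    by (rule approx_by_geg_sum[OF F \<epsilon>]) (rule that)
  define G where "G t = (\<Sum>m\<le>N. (a m)\<^sup>2 * geg_sq m * coef F m * P m t)" for t
  have G: "continuous_on UNIV G" unfolding G_def by (intro continuous_intros)
  have "energy G \<mu> = (\<Sum>m\<le>N. (a m)\<^sup>2 * geg_sq m * coef F m * energy (P m) \<mu>)"
    unfolding G_def by (subst energy_sum[OF \<mu>]) (auto simp: energy_cmult[OF \<mu>] intro!: continuous_intros)
  also have "\<dots> \<ge> 0"
    by (intro sum_nonneg mult_nonneg_nonneg c energy_geg_nonneg[OF \<mu>] less_imp_le[OF geg_sq_pos]) auto
  finally have "0 \<le> energy G \<mu>" .
  moreover have "energy (\<lambda>t. (G t + (-1) * F t) + F t) \<mu> = energy (\<lambda>t. G t + (-1) * F t) \<mu> + energy F \<mu>"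
    by (intro energy_add[OF \<mu>] continuous_intros F G)
  moreover have "\<bar>energy (\<lambda>t. G t + (-1) * F t) \<mu>\<bar> \<le> \<epsilon>"
    using a by (intro energy_bound[OF \<mu>]) (simp add: G_def)
  ultimately show "0 \<le> energy F \<mu> + \<epsilon>" by simp
qed

lemma coef_add_cmult:
  assumes "continuous_on UNIV F" "continuous_on UNIV G"
  shows "coef (\<lambda>t. F t + c * G t) n = coef F n + c * coef G n"
proof -
  have "coef (\<lambda>t. F t + c * G t) n = mean (\<lambda>t. F t * P n t + c * (G t * P n t))"
    by (simp add: coef_def algebra_simps)
  also have "\<dots> = coef F n + c * coef G n"
    unfolding coef_def mean_cmult[symmetric] by (intro mean_add continuous_intros assms)
  finally show ?thesis .
qed

lemma mean_geg: "n \<ge> 1 \<Longrightarrow> mean (P n) = 0"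
  by (rule geg_mean_zero)

lemma energy_lower_bound:
  fixes \<mu> :: "'a measure"
  assumes \<mu>: "\<mu> \<in> sphere_prob_measures" and F: "continuous_on UNIV F"
    and c: "\<And>m. m \<ge> 1 \<Longrightarrow> coef F m \<ge> 0" and n: "n \<ge> 1"
  shows "energy F \<mu> \<ge> mean F + coef F n / geg_sq n * energy (P n) \<mu>"
proof -
  \<comment> \<open>Removes the terms 0 and n and leaves the other coefficients unchanged. The
    division by \<open>geg_sq n\<close> compensates for
    \<open>coef (P n) n = geg_sq n\<close>.\<close>
  define G where "G t = F t + (- mean F) * P 0 t" for t
  define H where "H t = G t + (- (coef F n / geg_sq n)) * P n t" for t
  have G: "continuous_on UNIV G" unfolding G_def by (intro continuous_intros F)
  have H: "continuous_on UNIV H" unfolding H_def by (intro continuous_intros G)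
  have F0: "coef F 0 = mean F" "geg_sq 0 = 1" by (simp_all add: coef_def geg_sq_def mean_const)
  have "coef G m = coef F m + (- mean F) * coef (P 0) m" for m
    unfolding G_def by (intro coef_add_cmult continuous_intros F)
  moreover have "coef H m = coef G m + (- (coef F n / geg_sq n)) * coef (P n) m" for m
    unfolding H_def by (intro coef_add_cmult continuous_intros G)
  ultimately have "coef H m \<ge> 0" for m
    using c[of m] n geg_sq_pos[of n] F0 by (cases "m = 0") (auto simp: coef_geg simp del: geg.simps)
  then have "0 \<le> energy H \<mu>" by (rule energy_nonneg[OF \<mu> H])
  also have "\<dots> = energy F \<mu> - mean F - coef F n / geg_sq n * energy (P n) \<mu>"
  proof -
    have "energy H \<mu> = energy G \<mu> + energy (\<lambda>t. (- (coef F n / geg_sq n)) * P n t) \<mu>"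
      unfolding H_def by (intro energy_add[OF \<mu>] continuous_intros G)
    moreover have "energy G \<mu> = energy F \<mu> + energy (\<lambda>t. (- mean F) * P 0 t) \<mu>"
      unfolding G_def by (intro energy_add[OF \<mu>] continuous_intros F)
    moreover have "energy (P 0) \<mu> = 1" using energy_const[OF \<mu>, of 1] by (simp add: energy_def)
    ultimately show ?thesis by (simp only: energy_cmult[OF \<mu>])
  qed
  finally show ?thesis by simp
qed

end

text \<open>The indicator of a closed set \<open>C\<close> is the limit of \<open>max 0 (1 - k * infdist x C)\<close>.\<close>

lemma sphere_prob_measures_eqI:
  fixes \<mu> \<nu> :: "'a::euclidean_space measure"
  assumes \<mu>: "\<mu> \<in> sphere_prob_measures" and \<nu>: "\<nu> \<in> sphere_prob_measures"
    and eq: "\<And>\<phi> :: 'a \<Rightarrow> real. continuous_on UNIV \<phi> \<Longrightarrow> (\<integral>x. \<phi> x \<partial>\<mu>) = (\<integral>x. \<phi> x \<partial>\<nu>)"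
  shows "\<mu> = \<nu>"
proof -
  have lim: "(\<lambda>k. \<integral>x. max 0 (1 - real k * infdist x C) \<partial>\<kappa>) \<longlonglongrightarrow> measure \<kappa> (C \<inter> space \<kappa>)"
    if \<kappa>: "\<kappa> \<in> sphere_prob_measures" and C: "closed C" "C \<noteq> {}" for \<kappa> and C :: "'a set"
  proof -
    interpret prob_space \<kappa> by (rule prob_space_sphere_prob[OF \<kappa>])
    have "(\<lambda>k. \<integral>x. max 0 (1 - real k * infdist x C) \<partial>\<kappa>) \<longlonglongrightarrow> (\<integral>x. indicator C x \<partial>\<kappa>)"
    proof (rule integral_dominated_convergence[where w = "\<lambda>_. 1"])
      show "(indicator C :: 'a \<Rightarrow> real) \<in> borel_measurable \<kappa>"
        using C by (intro measurable_sphere_prob[OF \<kappa>] borel_measurable_indicator) auto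
      show "(\<lambda>x. max 0 (1 - real k * infdist x C)) \<in> borel_measurable \<kappa>" for k
        by (intro measurable_continuous_sphere[OF \<kappa>] continuous_intros)
      show "AE x in \<kappa>. (\<lambda>k. max 0 (1 - real k * infdist x C)) \<longlonglongrightarrow> indicator C x"
      proof (rule AE_I2)
        fix x
        show "(\<lambda>k. max 0 (1 - real k * infdist x C)) \<longlonglongrightarrow> indicator C x"
        proof (cases "x \<in> C")
          case False
          then have "infdist x C > 0"
            using in_closed_iff_infdist_zero[OF C] infdist_nonneg[of x C] by (simp add: less_le)
          then obtain K :: nat where K: "1 / infdist x C \<le> real K" "K \<ge> 0"
            using real_arch_simple by blast
          have "eventually (\<lambda>k. max 0 (1 - real k * infdist x C) = indicator C x) sequentially"
            using eventually_ge_at_top[of K]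
          proof eventually_elim
            case (elim k)
            then have "1 / infdist x C \<le> real k" using K(1) by linarith
            then show ?case using \<open>infdist x C > 0\<close> False by (simp add: field_simps)
          qed
          then show ?thesis by (rule tendsto_eventually)
        qed simp
      qed
      show "AE x in \<kappa>. norm (max 0 (1 - real k * infdist x C)) \<le> 1" for k
        by (intro AE_I2) (simp add: infdist_nonneg)
    qed simp
    then show ?thesis by simp
  qed
  \<comment> \<open>Pushed forward to \<open>borel\<close> on the whole space, the measures can be
    compared on the closed sets, an intersection-stable generator.\<close>
  define D where "D \<kappa> = distr \<kappa> borel (\<lambda>x::'a. x)" for \<kappa>
  have D: "emeasure (D \<kappa>) A = emeasure \<kappa> (A \<inter> space \<kappa>)"
    if "\<kappa> \<in> sphere_prob_measures" "A \<in> sets borel" for \<kappa> A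
    unfolding D_def using emeasure_distr[OF measurable_ident_sphere_prob[OF that(1)] that(2)] by simp
  have "D \<mu> = D \<nu>"
  proof (rule measure_eqI_generator_eq[where E = "Collect closed" and \<Omega> = UNIV and A = "\<lambda>_. UNIV"])
    show "sets (D \<mu>) = sigma_sets UNIV (Collect closed)" "sets (D \<nu>) = sigma_sets UNIV (Collect closed)"
      by (simp_all add: D_def borel_eq_closed)
    show "emeasure (D \<mu>) UNIV \<noteq> \<infinity>"
      using prob_space.emeasure_space_1[OF prob_space_sphere_prob[OF \<mu>]] by (simp add: D[OF \<mu>])
    fix C :: "'a set" assume "C \<in> Collect closed"
    then have C: "closed C" by simp
    show "emeasure (D \<mu>) C = emeasure (D \<nu>) C"
    proof (cases "C = {}")
      case False
      have "(\<integral>x. max 0 (1 - real k * infdist x C) \<partial>\<mu>) = (\<integral>x. max 0 (1 - real k * infdist x C) \<partial>\<nu>)" for k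
        by (intro eq continuous_intros)
      then have "measure \<mu> (C \<inter> space \<mu>) = measure \<nu> (C \<inter> space \<nu>)"
        using LIMSEQ_unique[OF lim[OF \<mu> C False]] lim[OF \<nu> C False] by simp
      then show ?thesis
        using C by (simp add: D \<mu> \<nu> finite_measure.emeasure_eq_measure
            prob_space.finite_measure prob_space_sphere_prob)
    qed simp
  qed (auto simp: Int_stable_def)
  show ?thesis
  proof (rule measure_eqI)
    show "sets \<mu> = sets \<nu>" by (simp add: sets_sphere_prob \<mu> \<nu>)
    fix A assume A: "A \<in> sets \<mu>"
    then have "A \<in> sets borel" "A \<inter> space \<mu> = A" "A \<inter> space \<nu> = A"
      using sets.sets_into_space[OF A]
      by (auto simp: sets_sphere_prob[OF \<mu>] space_sphere_prob \<mu> \<nu> sphere_borel_def sets_restrict_space)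
    then show "emeasure \<mu> A = emeasure \<nu> A"
      using D[OF \<mu>, of A] D[OF \<nu>, of A] \<open>D \<mu> = D \<nu>\<close> by simp
  qed
qed

section \<open>Minimality and uniqueness of \<open>\<sigma>\<close>, and the converse
  perturbation\<close>

context zonal
begin

text \<open>A vanishing energy of \<open>P n\<close> means that the potential of
  \<open>\<mu>\<close> under \<open>P n\<close> is 0 almost everywhere. So the smoothing of
  \<open>\<phi>\<close> by any \<open>q\<close> of mean 1 has \<open>\<mu>\<close>-integral equal to
  the \<open>\<sigma>\<close>-integral of \<open>\<phi>\<close>; for peaked \<open>q\<close> it is
  close to the \<open>\<mu>\<close>-integral of \<open>\<phi>\<close>.\<close>

lemma eq_sigma_if_geg_energies_vanish:
  fixes \<mu> :: "'a measure"
  assumes \<mu>: "\<mu> \<in> sphere_prob_measures" and z: "\<And>n. n \<ge> 1 \<Longrightarrow> energy (P n) \<mu> = 0"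
  shows "\<mu> = \<sigma>"
proof (rule sphere_prob_measures_eqI[OF \<mu> sigma_in])
  fix \<phi> :: "'a \<Rightarrow> real" assume \<phi>: "continuous_on UNIV \<phi>"
  have AE0: "AE z in \<sigma>. (\<integral>x. P n (x \<bullet> z) \<partial>\<mu>) = 0" if "n \<ge> 1" for n
    using integral_nonneg_eq_0_iff_AE[OF integrable_potential_square[OF \<mu>, of n]]
      energy_geg[OF \<mu>, of n] z[OF that] by simp
  have conv: "(\<integral>x. (\<integral>z. poly q (x \<bullet> z) * \<phi> z \<partial>\<sigma>) \<partial>\<mu>) = (\<integral>z. \<phi> z \<partial>\<sigma>)" if q: "mean (poly q) = 1" for q
  proof -
    obtain a where "q = (\<Sum>m\<le>degree q. smult (a m) (geg l m))"
      using geg_expansion[OF l order_refl] by blast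
    from arg_cong[OF this, of poly] have qa: "poly q t = (\<Sum>m\<le>degree q. a m * P m t)" for t
      by (simp add: poly_sum)
    \<comment> \<open>The term 0 of \<open>q\<close> carries its mean; it is the only one whose
      potential survives.\<close>
    have a0: "a 0 = 1"
      using coef_sum_geg[OF qa, of 0] q by (simp add: coef_def geg_sq_def mean_const)
    have c: "continuous_on UNIV (\<lambda>(x, z :: 'a). poly q (x \<bullet> z) * \<phi> z)"
      unfolding case_prod_unfold by (intro continuous_intros continuous_on_compose2[OF \<phi>]) auto
    have c': "continuous_on UNIV (\<lambda>(z, x :: 'a). poly q (x \<bullet> z) * \<phi> z)"
      unfolding case_prod_unfold by (intro continuous_intros continuous_on_compose2[OF \<phi>]) auto
    have "(\<integral>x. (\<integral>z. poly q (x \<bullet> z) * \<phi> z \<partial>\<sigma>) \<partial>\<mu>) = (\<integral>z. (\<integral>x. poly q (x \<bullet> z) * \<phi> z \<partial>\<mu>) \<partial>\<sigma>)"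
      by (rule integral_swap_continuous[OF \<mu> sigma_in c, symmetric])
    also have "\<dots> = (\<integral>z. \<phi> z \<partial>\<sigma>)"
    proof (rule integral_cong_AE)
      show "(\<lambda>z. \<integral>x. poly q (x \<bullet> z) * \<phi> z \<partial>\<mu>) \<in> borel_measurable \<sigma>"
        by (rule measurable_inner_integral[OF sigma_in \<mu> c'])
      show "\<phi> \<in> borel_measurable \<sigma>" by (rule measurable_continuous_sphere[OF sigma_in \<phi>])
      have "AE z in \<sigma>. \<forall>m\<in>{1..degree q}. (\<integral>x. P m (x \<bullet> z) \<partial>\<mu>) = 0"
        using AE0 by (intro AE_finite_allI) auto
      then show "AE z in \<sigma>. (\<integral>x. poly q (x \<bullet> z) * \<phi> z \<partial>\<mu>) = \<phi> z"
      proof (rule AE_mp, intro AE_I2 impI)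
        fix z :: 'a assume z: "\<forall>m\<in>{1..degree q}. (\<integral>x. P m (x \<bullet> z) \<partial>\<mu>) = 0"
        have "(\<integral>x. poly q (x \<bullet> z) \<partial>\<mu>) = (\<Sum>m\<le>degree q. a m * (\<integral>x. P m (x \<bullet> z) \<partial>\<mu>))"
          unfolding qa
          by (subst Bochner_Integration.integral_sum)
            (auto intro!: integrable_continuous_sphere[OF \<mu>] continuous_intros)
        also have "\<dots> = (\<Sum>m\<le>degree q. if m = 0 then 1 else 0)"
          using z prob_space.prob_space[OF prob_space_sphere_prob[OF \<mu>]]
          by (intro sum.cong) (auto simp: a0)
        also have "\<dots> = 1" by (simp add: sum.delta)
        finally show "(\<integral>x. poly q (x \<bullet> z) * \<phi> z \<partial>\<mu>) = \<phi> z" by simp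
      qed
    qed
    finally show ?thesis .
  qed
  have "\<bar>(\<integral>x. \<phi> x \<partial>\<sigma>) - (\<integral>x. \<phi> x \<partial>\<mu>)\<bar> \<le> 0 + \<epsilon>" if \<epsilon>: "\<epsilon> > 0" for \<epsilon>
  proof -
    obtain C where C: "C \<ge> 0" "\<And>x y. x \<in> sphere 0 1 \<Longrightarrow> y \<in> sphere 0 1 \<Longrightarrow> \<bar>\<phi> x - \<phi> y\<bar> \<le> \<epsilon> / 2 + C * (dist x y)\<^sup>2"
      using quadratic_modulus[of "sphere 0 1" \<phi> "\<epsilon> / 2"] continuous_on_subset[OF \<phi>] \<epsilon> by auto
    obtain q where q: "\<And>t. \<bar>t\<bar> \<le> 1 \<Longrightarrow> poly q t \<ge> 0" "mean (poly q) = 1"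
      and q_peak: "mean (\<lambda>t. poly q t * (1 - t)) \<le> \<epsilon> / (4 * (C + 1))"
      using obtain_peak_kernel[of "\<epsilon> / (4 * (C + 1))"] \<epsilon> C(1) by auto
    have "2 * C * mean (\<lambda>t. poly q t * (1 - t)) \<le> 2 * C * (\<epsilon> / (4 * (C + 1)))"
      using C(1) by (intro mult_left_mono q_peak) auto
    also have "\<dots> \<le> \<epsilon> / 2" using C(1) \<epsilon> by (simp add: field_simps)
    finally have \<eta>: "2 * C * mean (\<lambda>t. poly q t * (1 - t)) \<le> \<epsilon> / 2" .
    have "\<bar>(\<integral>z. poly q (x \<bullet> z) * \<phi> z \<partial>\<sigma>) - \<phi> x\<bar> \<le> \<epsilon>" if x: "norm x = 1" for x
    proof -
      have "\<bar>(\<integral>z. poly q (x \<bullet> z) * \<phi> z \<partial>\<sigma>) - \<phi> x\<bar> \<le> \<epsilon> / 2 + 2 * C * mean (\<lambda>t. poly q t * (1 - t))"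
      proof (rule peak_kernel_approx[OF q \<phi> x])
        fix z :: 'a assume "norm z = 1"
        then show "\<bar>\<phi> z - \<phi> x\<bar> \<le> \<epsilon> / 2 + 2 * C * (1 - x \<bullet> z)"
          using C(2)[of z x] dist_square_unit[of z x] x by (simp add: inner_commute algebra_simps)
      qed
      then show ?thesis using \<eta> by linarith
    qed
    then have "\<bar>\<integral>x. (\<integral>z. poly q (x \<bullet> z) * \<phi> z \<partial>\<sigma>) - \<phi> x \<partial>\<mu>\<bar> \<le> \<epsilon>"
      by (rule abs_integral_sphere_prob_le[OF \<mu>])
    moreover have "integrable \<mu> (\<lambda>x. \<integral>z. poly q (x \<bullet> z) * \<phi> z \<partial>\<sigma>)"
    proof (rule integrable_inner_integral[OF \<mu> sigma_in])
      show "continuous_on UNIV (\<lambda>(x, z :: 'a). poly q (x \<bullet> z) * \<phi> z)"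
        unfolding case_prod_unfold by (intro continuous_intros continuous_on_compose2[OF \<phi>]) auto
    qed
    ultimately show ?thesis
      using conv[OF q(2)] integrable_continuous_sphere[OF \<mu> \<phi>] by simp
  qed
  then have "\<bar>(\<integral>x. \<phi> x \<partial>\<sigma>) - (\<integral>x. \<phi> x \<partial>\<mu>)\<bar> \<le> 0" by (rule field_le_epsilon)
  then show "(\<integral>x. \<phi> x \<partial>\<mu>) = (\<integral>x. \<phi> x \<partial>\<sigma>)" by simp
qed

text \<open>For the inequality the lower bound at n = 1 is enough; equality uses it for every n,
  each time forcing the energy of \<open>P n\<close> to vanish.\<close>

lemma energy_minimal_at_sigma:
  fixes \<mu> :: "'a measure"
  assumes \<mu>: "\<mu> \<in> sphere_prob_measures" and F: "continuous_on UNIV F"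
    and c: "\<And>n. n \<ge> 1 \<Longrightarrow> coef F n > 0"
  shows "energy F (\<sigma> :: 'a measure) \<le> energy F \<mu>"
    and "energy F \<mu> \<le> energy F (\<sigma> :: 'a measure) \<Longrightarrow> \<mu> = \<sigma>"
proof -
  have lower: "energy F (\<sigma> :: 'a measure) + coef F n / geg_sq n * energy (P n) \<mu> \<le> energy F \<mu>" if "n \<ge> 1" for n
    using energy_lower_bound[OF \<mu> F less_imp_le[OF c] that] by (simp add: energy_sigma[OF F])
  have pos: "coef F n / geg_sq n > 0" if "n \<ge> 1" for n
    using c[OF that] geg_sq_pos[of n] by simp
  show "energy F (\<sigma> :: 'a measure) \<le> energy F \<mu>"
    using lower[of 1] mult_nonneg_nonneg[OF less_imp_le[OF pos[of 1]] energy_geg_nonneg[OF \<mu>, of 1]]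
    by (simp del: geg.simps)
  assume le: "energy F \<mu> \<le> energy F (\<sigma> :: 'a measure)"
  show "\<mu> = \<sigma>"
  proof (rule eq_sigma_if_geg_energies_vanish[OF \<mu>])
    fix n :: nat assume n: "n \<ge> 1"
    have "coef F n / geg_sq n * energy (P n) \<mu> \<le> 0" using lower[OF n] le by linarith
    then have "energy (P n) \<mu> \<le> 0" using pos[OF n] by (metis linorder_not_less mult_pos_pos)
    then show "energy (P n) \<mu> = 0" using energy_geg_nonneg[OF \<mu>, of n] by simp
  qed
qed

lemma coef_pos_if_unique_minimizer:
  assumes F: "continuous_on UNIV F" and n: "n \<ge> 1"
    and min: "\<And>\<mu> :: 'a measure. \<mu> \<in> sphere_prob_measures \<Longrightarrow> \<mu> \<noteq> \<sigma> \<Longrightarrow> energy F (\<sigma> :: 'a measure) < energy F \<mu>"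
  shows "coef F n > 0"
proof -
  \<comment> \<open>1/B is the size of the perturbation: it keeps the density \<open>\<rho>\<close>
    nonnegative on [-1,1].\<close>
  obtain B where B: "B > 0" "\<And>t. \<bar>t\<bar> \<le> 1 \<Longrightarrow> \<bar>P n t\<bar> \<le> B"
    using continuous_bounded_on_unit[of "P n"] continuous_on_poly_comp[OF continuous_on_id] by blast
  define \<rho> where "\<rho> t = 1 + P n t / B" for t
  define \<mu> where "\<mu> = density (\<sigma> :: 'a measure) (\<lambda>x. ennreal (\<rho> (e \<bullet> x)))"
  have \<rho>_cont: "continuous_on UNIV \<rho>" unfolding \<rho>_def using B(1) by (intro continuous_intros) auto
  have \<rho>0: "\<rho> t \<ge> 0" if "\<bar>t\<bar> \<le> 1" for t
    using B(2)[OF that] B(1) by (auto simp: \<rho>_def field_simps abs_le_iff)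
  have AE\<rho>: "AE x in \<sigma>. 0 \<le> \<rho> (e \<bullet> x)"
    by (intro AE_I2 \<rho>0 abs_inner_unit_le norm_e) (simp add: space_sphere_prob[OF sigma_in])
  have \<rho>_meas: "(\<lambda>x. \<rho> (e \<bullet> x)) \<in> borel_measurable \<sigma>"
    by (intro measurable_continuous_sphere[OF sigma_in] continuous_on_real_comp[OF \<rho>_cont] continuous_intros)
  have int: "(\<integral>x. f x \<partial>\<mu>) = (\<integral>x. \<rho> (e \<bullet> x) * f x \<partial>\<sigma>)" if "f \<in> borel_measurable \<sigma>" for f :: "'a \<Rightarrow> real"
    unfolding \<mu>_def using integral_density[OF that \<rho>_meas AE\<rho>] by simp
  \<comment> \<open>Evaluated three times: (a, b) = (1, 0) gives total mass 1, (0, 1) separates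
    \<open>\<mu>\<close> from \<open>\<sigma>\<close>, and the potential of \<open>\<mu>\<close>
    gives the energy.\<close>
  have mean_quad: "mean (\<lambda>t. (a + b * P n t) * \<rho> t) = a + b * geg_sq n / B" for a b
  proof -
    have "mean (\<lambda>t. (a + b * P n t) * \<rho> t) = mean (\<lambda>t. a + ((a / B + b) * P n t + b / B * (P n t * P n t)))"
      by (simp add: \<rho>_def algebra_simps)
    also have "\<dots> = a + ((a / B + b) * mean (P n) + b / B * mean (\<lambda>t. P n t * P n t))"
      by (subst mean_add, (intro continuous_intros)+)
        (subst mean_add, (intro continuous_intros)+, simp only: mean_cmult mean_const)
    finally show ?thesis by (simp add: mean_geg[OF n] geg_sq_def coef_def)
  qed
  have mean\<rho>: "mean \<rho> = 1" using mean_quad[of 1 0] by simp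
  have \<mu>: "\<mu> \<in> sphere_prob_measures"
  proof -
    have "emeasure \<mu> (space \<mu>) = (\<integral>\<^sup>+x. ennreal (\<rho> (e \<bullet> x)) \<partial>\<sigma>)"
      unfolding \<mu>_def using \<rho>_meas by (subst emeasure_density) (auto intro!: nn_integral_cong)
    also have "\<dots> = ennreal (\<integral>x. \<rho> (e \<bullet> x) \<partial>\<sigma>)"
      by (rule nn_integral_eq_integral[OF integrable_mean[OF \<rho>_cont] AE\<rho>])
    also have "\<dots> = 1" using mean\<rho> by (simp add: zonal_mean_def)
    finally show ?thesis
      by (auto simp: sphere_prob_measures_def \<mu>_def sets_sphere_prob[OF sigma_in] intro!: prob_spaceI)
  qed
  have P_meas: "(\<lambda>x. P n (e \<bullet> x)) \<in> borel_measurable \<sigma>"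
    by (intro measurable_continuous_sphere[OF sigma_in] continuous_intros)
  have "\<mu> \<noteq> \<sigma>"
  proof
    assume "\<mu> = \<sigma>"
    then have "mean (P n) = (\<integral>x. P n (e \<bullet> x) \<partial>\<mu>)" by (simp add: zonal_mean_def)
    also have "\<dots> = mean (\<lambda>t. (0 + 1 * P n t) * \<rho> t)"
      unfolding int[OF P_meas] by (simp add: zonal_mean_def mult.commute)
    also have "\<dots> = geg_sq n / B" unfolding mean_quad by simp
    finally show False using mean_geg[OF n] geg_sq_pos[of n] B(1) by simp
  qed
  from min[OF \<mu> this] have "mean F < energy F \<mu>" by (simp add: energy_sigma[OF F])
  \<comment> \<open>By Funk-Hecke the potential of \<open>\<mu>\<close> is a constant plus a
    multiple of \<open>P n\<close>. The terms linear in the perturbation integrate to 0, leaving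
    \<open>coef F n * geg_sq n / (B * B)\<close>.\<close>
  also have "energy F \<mu> = (\<integral>y. mean F + coef F n / B * P n (e \<bullet> y) \<partial>\<mu>)"
    unfolding energy_def
  proof (rule integral_cong_sphere_prob[OF \<mu>])
    fix y :: 'a assume y: "norm y = 1"
    have Fint: "integrable \<sigma> (\<lambda>x. F (y \<bullet> x))" "integrable \<sigma> (\<lambda>x. F (y \<bullet> x) * P n (x \<bullet> e))"
      by (intro integrable_continuous_sphere[OF sigma_in] continuous_intros continuous_on_real_comp[OF F])+
    have "(\<integral>x. F (x \<bullet> y) \<partial>\<mu>) = (\<integral>x. F (y \<bullet> x) \<partial>\<mu>)" by (simp add: inner_commute)
    also have "\<dots> = (\<integral>x. F (y \<bullet> x) + F (y \<bullet> x) * P n (x \<bullet> e) / B \<partial>\<sigma>)"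
      unfolding int[OF borel_measurable_integrable[OF Fint(1)]]
      by (simp add: \<rho>_def algebra_simps inner_commute)
    also have "\<dots> = (\<integral>x. F (y \<bullet> x) \<partial>\<sigma>) + (\<integral>x. F (y \<bullet> x) * P n (x \<bullet> e) \<partial>\<sigma>) / B"
      using Fint by simp
    finally show "(\<integral>x. F (x \<bullet> y) \<partial>\<mu>) = mean F + coef F n / B * P n (e \<bullet> y)"
      unfolding mean_eq[OF F y] Funk_Hecke_coef[OF F y norm_e] by (simp add: inner_commute)
  qed
  also have "\<dots> = mean (\<lambda>t. (mean F + coef F n / B * P n t) * \<rho> t)"
    using P_meas by (subst int) (auto simp: zonal_mean_def mult.commute)
  also have "\<dots> = mean F + coef F n / B * geg_sq n / B" by (rule mean_quad)
  finally have "0 < coef F n * geg_sq n / (B * B)" by (simp add: mult.assoc)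
  then show ?thesis using geg_sq_pos[of n] B(1) by (simp add: zero_less_divide_iff zero_less_mult_iff)
qed

end

subsection \<open>The Gegenbauer weight\<close>

lemma weight_nonneg: "gegenbauer_weight l t \<ge> 0"
  by (simp add: gegenbauer_weight_def)

lemma measurable_weight [measurable]: "gegenbauer_weight l \<in> borel_measurable borel"
  unfolding gegenbauer_weight_def by measurable

text \<open>For a nonnegative function gauge integrability is absolute integrability, so an
  antiderivative continuous up to the end points certifies integrability of an unbounded
  weight.\<close>

lemma set_integrable_lborel_nonneg:
  fixes g :: "real \<Rightarrow> real"
  assumes g: "g \<in> borel_measurable borel" "(g has_integral I) {-1..1}" "\<And>t. g t \<ge> 0"
  shows "set_integrable lborel {-1..1} g"
proof -
  have "set_integrable lebesgue {-1..1} g"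
    using g(2,3) by (intro nonnegative_absolutely_integrable_1) (auto simp: integrable_on_def)
  then show ?thesis
    unfolding set_integrable_def using g(1)
    by (subst (asm) integrable_completion) (auto intro!: borel_measurable_scaleR borel_measurable_indicator)
qed

text \<open>For \<open>l \<ge> 0\<close> the weight is dominated by the derivative of \<open>arcsin\<close>.\<close>

lemma set_integrable_weight:
  assumes "l \<ge> 0"
  shows "set_integrable lborel {-1..1} (gegenbauer_weight l)"
proof (rule set_integrable_bound)
  show "set_integrable lborel {-1..1} (gegenbauer_weight 0)"
  proof (rule set_integrable_lborel_nonneg)
    show "(gegenbauer_weight 0 has_integral (arcsin 1 - arcsin (-1))) {-1..1}"
    proof (rule fundamental_theorem_of_calculus_interior)
      fix t :: real assume t: "t \<in> {-1<..<1}"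
      then have "t\<^sup>2 < 1" by (auto simp: abs_square_less_1)
      then have "gegenbauer_weight 0 t = inverse (sqrt (1 - t\<^sup>2))"
        by (simp add: gegenbauer_weight_def powr_minus powr_half_sqrt)
      then show "(arcsin has_vector_derivative gegenbauer_weight 0 t) (at t)"
        using DERIV_arcsin[of t] t by (simp add: has_real_derivative_iff_has_vector_derivative)
    qed (auto intro: continuous_on_arcsin')
  qed (auto simp: weight_nonneg)
  show "AE t in lborel. t \<in> {-1..1} \<longrightarrow> norm (gegenbauer_weight l t) \<le> norm (gegenbauer_weight 0 t)"
  proof (rule AE_I2, rule impI)
    fix t :: real assume "t \<in> {-1..1}"
    then have "0 \<le> 1 - t\<^sup>2" "1 - t\<^sup>2 \<le> 1" by (auto simp: abs_square_le_1 abs_le_iff)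
    \<comment> \<open>At the end points both sides are 0 by the convention
      \<open>0 powr a = 0\<close>; elsewhere a base in (0,1] makes the power decreasing in the
      exponent.\<close>
    then have "(1 - t\<^sup>2) powr (l - 1 / 2) \<le> (1 - t\<^sup>2) powr (0 - 1 / 2)"
      using assms by (cases "1 - t\<^sup>2 = 0") (auto intro!: powr_mono')
    then show "norm (gegenbauer_weight l t) \<le> norm (gegenbauer_weight 0 t)" by (simp add: gegenbauer_weight_def)
  qed
qed (simp add: set_borel_measurable_def)

lemma set_integrable_times_weight:
  assumes l: "l \<ge> 0" and F: "continuous_on UNIV F"
  shows "set_integrable lborel {-1..1} (\<lambda>t. F t * gegenbauer_weight l t)"
proof -
  obtain B where B: "B > 0" "\<And>t. \<bar>t\<bar> \<le> 1 \<Longrightarrow> \<bar>F t\<bar> \<le> B"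
    using continuous_bounded_on_unit[OF F] by blast
  have [measurable]: "F \<in> borel_measurable borel" by (rule borel_measurable_continuous_onI[OF F])
  show ?thesis
  proof (rule set_integrable_bound)
    show "set_integrable lborel {-1..1} (\<lambda>t. B * gegenbauer_weight l t)"
      by (intro set_integrable_mult_right set_integrable_weight l)
    show "AE t in lborel. t \<in> {-1..1} \<longrightarrow> norm (F t * gegenbauer_weight l t) \<le> norm (B * gegenbauer_weight l t)"
      using B by (intro AE_I2 impI) (auto simp: abs_mult weight_nonneg abs_le_iff intro!: mult_right_mono)
  qed (simp add: set_borel_measurable_def)
qed

section \<open>The normalised weight as a moment functional\<close>

definition weight_mean :: "real \<Rightarrow> (real \<Rightarrow> real) \<Rightarrow> real" where
  "weight_mean l F = inverse (LBINT t:{-1..1}. gegenbauer_weight l t) * (LBINT t:{-1..1}. F t * gegenbauer_weight l t)"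

text \<open>On [-1/2,1/2] the exponent l - 1/2 is first raised to l, which lowers the power and
  avoids a distinction by the sign of l - 1/2; then 1 - t^2 >= 3/4.\<close>

lemma weight_mass_pos:
  assumes "l \<ge> 0"
  shows "(LBINT t:{-1..1}. gegenbauer_weight l t) > 0"
proof -
  have half: "set_integrable lborel {-1/2..1/2} (gegenbauer_weight l)"
    by (rule set_integrable_subset[OF set_integrable_weight[OF assms]]) auto
  have "0 < (LBINT t:{-1/2..1/2::real}. (3/4) powr l :: real)"
    by (simp add: set_lebesgue_integral_def)
  also have "\<dots> \<le> (LBINT t:{-1/2..1/2}. gegenbauer_weight l t)"
  proof (rule set_integral_mono)
    show "set_integrable lborel {-1/2..1/2} (gegenbauer_weight l)" by (rule half)
    fix t :: real assume "t \<in> {-1/2..1/2}"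
    then have "t\<^sup>2 \<le> (1/2)\<^sup>2" by (intro abs_le_square_iff[THEN iffD1]) (auto simp: abs_le_iff)
    then have t: "3/4 \<le> 1 - t\<^sup>2" "1 - t\<^sup>2 \<le> 1" by (auto simp: power2_eq_square)
    have "(3/4) powr l \<le> (1 - t\<^sup>2) powr l" using t assms by (intro powr_mono2) auto
    also have "\<dots> \<le> (1 - t\<^sup>2) powr (l - 1/2)" using t by (intro powr_mono') auto
    finally show "(3/4) powr l \<le> gegenbauer_weight l t" by (simp add: gegenbauer_weight_def)
  qed (simp add: set_integrable_def)
  also have "\<dots> \<le> (LBINT t:{-1..1}. gegenbauer_weight l t)"
    unfolding set_lebesgue_integral_def
    using half set_integrable_weight[OF assms] unfolding set_integrable_def
    by (rule integral_mono) (auto simp: weight_nonneg indicator_def)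
  finally show ?thesis .
qed

text \<open>The integrand is the derivative of t^j (1 - t^2)^(l + 1/2), which vanishes at both end
  points. For \<open>j = 0\<close> the truncated exponent \<open>j - 1\<close> is harmless because
  of the factor \<open>j\<close>.\<close>

lemma weight_by_parts:
  assumes l: "l \<ge> 0"
  shows "(LBINT t:{-1..1}. (real j * t ^ (j - 1) * (1 - t\<^sup>2) - (2 * l + 1) * t ^ (j + 1)) * gegenbauer_weight l t) = 0"
proof -
  let ?f = "\<lambda>t. t ^ j * (1 - t\<^sup>2) powr (l + 1/2)"
  let ?g = "\<lambda>t. (real j * t ^ (j - 1) * (1 - t\<^sup>2) - (2 * l + 1) * t ^ (j + 1)) * gegenbauer_weight l t"
  have "(?g has_integral (?f 1 - ?f (-1))) {-1..1}"
  proof (rule fundamental_theorem_of_calculus_interior)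
    show "continuous_on {-1..1} ?f"
      using l by (intro continuous_intros continuous_on_powr') (auto simp: abs_square_le_1 abs_le_iff)
    fix t :: real assume "t \<in> {-1<..<1}"
    then have t: "0 < 1 - t\<^sup>2" by (auto simp: abs_square_less_1)
    have p: "(1 - t\<^sup>2) powr (l + 1/2) = (1 - t\<^sup>2) * gegenbauer_weight l t"
      using t powr_add[of "1 - t\<^sup>2" 1 "l - 1/2"] by (simp add: gegenbauer_weight_def add.commute)
    have "((\<lambda>t. (1 - t\<^sup>2) powr (l + 1/2)) has_real_derivative ((l + 1/2) * (1 - t\<^sup>2) powr (l + 1/2 - 1) * (- (2 * t)))) (at t)"
      using t by (auto intro!: derivative_eq_intros)
    moreover have "(l + 1/2) * (1 - t\<^sup>2) powr (l + 1/2 - 1) * (- (2 * t)) = - (2 * l + 1) * t * gegenbauer_weight l t"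
      by (simp add: gegenbauer_weight_def algebra_simps)
    ultimately have "((\<lambda>t. (1 - t\<^sup>2) powr (l + 1/2)) has_real_derivative (- (2 * l + 1) * t * gegenbauer_weight l t)) (at t)"
      by simp
    from DERIV_mult[OF DERIV_pow[of j t] this]
    have "(?f has_real_derivative ?g t) (at t)"
      by (rule DERIV_cong) (simp add: p algebra_simps)
    then show "(?f has_vector_derivative ?g t) (at t)"
      by (simp add: has_real_derivative_iff_has_vector_derivative)
  qed auto
  then have "integral {-1..1} ?g = 0" by (simp add: integral_unique)
  moreover have "set_integrable lborel {-1..1} ?g"
    by (intro set_integrable_times_weight l continuous_intros)
  ultimately show ?thesis by (simp add: set_borel_integral_eq_integral(2))
qed

lemma weight_mean_add:
  assumes "l \<ge> 0" "continuous_on UNIV F" "continuous_on UNIV G"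
  shows "weight_mean l (\<lambda>t. F t + G t) = weight_mean l F + weight_mean l G"
  using assms unfolding weight_mean_def distrib_right
  by (subst set_integral_add) (auto intro!: set_integrable_times_weight simp: distrib_left)

lemma weight_mean_cmult: "weight_mean l (\<lambda>t. c * F t) = c * weight_mean l F"
  by (simp add: weight_mean_def mult.assoc)

lemma gegenbauer_functional_weight:
  assumes l: "l \<ge> 0"
  shows "gegenbauer_functional l (\<lambda>p. weight_mean l (poly p))"
proof
  \<comment> \<open>\<open>j = 0\<close> will give the vanishing first moment,
    \<open>j = k + 1\<close> the moment recurrence.\<close>
  have parts: "real j * weight_mean l (\<lambda>t. t ^ (j - 1)) - real j * weight_mean l (\<lambda>t. t ^ (j - 1) * t\<^sup>2) =
      (2 * l + 1) * weight_mean l (\<lambda>t. t ^ (j + 1))" for j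
  proof -
    have "0 = weight_mean l (\<lambda>t. real j * t ^ (j - 1) * (1 - t\<^sup>2) - (2 * l + 1) * t ^ (j + 1))"
      unfolding weight_mean_def using weight_by_parts[OF l, of j] by simp
    also have "\<dots> = weight_mean l (\<lambda>t. real j * t ^ (j - 1) + ((- real j) * (t ^ (j - 1) * t\<^sup>2) + (- (2 * l + 1)) * t ^ (j + 1)))"
      by (simp add: algebra_simps)
    also have "\<dots> = real j * weight_mean l (\<lambda>t. t ^ (j - 1)) + ((- real j) * weight_mean l (\<lambda>t. t ^ (j - 1) * t\<^sup>2)
        + (- (2 * l + 1)) * weight_mean l (\<lambda>t. t ^ (j + 1)))"
      by (simp only: weight_mean_add[OF l] weight_mean_cmult continuous_intros)
    finally show ?thesis by (simp add: algebra_simps)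
  qed
  show "weight_mean l (poly (p + q)) = weight_mean l (poly p) + weight_mean l (poly q)" for p q
    using weight_mean_add[OF l, of "poly p" "poly q"] by (simp add: continuous_intros poly_add[abs_def])
  show "weight_mean l (poly (smult c p)) = c * weight_mean l (poly p)" for c p
    using weight_mean_cmult[of l c "poly p"] by (simp add: poly_smult[abs_def])
  show "weight_mean l (poly 1) = 1"
    using weight_mass_pos[OF l] by (simp add: weight_mean_def)
  show "weight_mean l (poly (monom 1 1)) = 0"
    using parts[of 0] l by (simp add: poly_monom[abs_def])
  show "(real k + 1) * (weight_mean l (poly (monom 1 k)) - weight_mean l (poly (monom 1 (k + 2)))) =
      (2 * l + 1) * weight_mean l (poly (monom 1 (k + 2)))" for k
    using parts[of "Suc k"] by (simp add: poly_monom[abs_def] algebra_simps power2_eq_square)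
qed (rule l)

lemma weight_mean_bound:
  assumes l: "l \<ge> 0" and F: "continuous_on UNIV F" and B: "\<And>t. \<bar>t\<bar> \<le> 1 \<Longrightarrow> \<bar>F t\<bar> \<le> B"
  shows "\<bar>weight_mean l F\<bar> \<le> B"
proof -
  let ?W = "LBINT t:{-1..1}. gegenbauer_weight l t"
  have "\<bar>LBINT t:{-1..1}. F t * gegenbauer_weight l t\<bar> \<le> (LBINT t:{-1..1}. \<bar>F t * gegenbauer_weight l t\<bar>)"
    using set_integral_norm_bound[OF set_integrable_times_weight[OF l F]] by simp
  also have "\<dots> \<le> (LBINT t:{-1..1}. B * gegenbauer_weight l t)"
  proof (rule set_integral_mono)
    show "set_integrable lborel {-1..1} (\<lambda>t. \<bar>F t * gegenbauer_weight l t\<bar>)"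
      by (rule set_integrable_abs[OF set_integrable_times_weight[OF l F]])
    show "\<bar>F t * gegenbauer_weight l t\<bar> \<le> B * gegenbauer_weight l t" if "t \<in> {-1..1}" for t
      using B[of t] that by (auto simp: abs_mult weight_nonneg intro!: mult_right_mono)
  qed (intro set_integrable_mult_right set_integrable_weight l)
  also have "\<dots> = B * ?W" by simp
  finally show ?thesis
    unfolding weight_mean_def using weight_mass_pos[OF l] by (simp add: abs_mult field_simps)
qed

context zonal
begin

text \<open>Both functionals satisfy the same moment recurrence, so they agree on polynomials.\<close>

lemma weight_mean_eq_mean:
  assumes F: "continuous_on UNIV F"
  shows "weight_mean l F = mean F"
proof -
  have "\<bar>weight_mean l F - mean F\<bar> \<le> 0 + \<epsilon>" if \<epsilon>: "\<epsilon> > 0" for \<epsilon>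
  proof -
    \<comment> \<open>Both functionals are bounded by the supremum over [-1,1], so polynomial
      approximation carries their agreement over to continuous functions.\<close>
    obtain g where g: "real_polynomial_function g" "\<And>t. t \<in> {-1..1} \<Longrightarrow> \<bar>F t - g t\<bar> < \<epsilon> / 2"
      by (rule Stone_Weierstrass_real_polynomial_function[OF compact_Icc[of "-1" 1]
            continuous_on_subset[OF F subset_UNIV] half_gt_zero[OF \<epsilon>]]) (rule that)
    obtain a n where "g = (\<lambda>t. \<Sum>i\<le>n. a i * t ^ i)"
      using g(1) unfolding real_polynomial_function_iff_sum by blast
    then have gp: "g = poly (\<Sum>i\<le>n. monom (a i) i)" by (auto simp: poly_sum poly_monom)
    define p where "p = (\<Sum>i\<le>n. monom (a i) i)"
    define D where "D t = F t + (-1) * poly p t" for t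
    have D: "continuous_on UNIV D" unfolding D_def by (intro continuous_intros F)
    have DB: "\<bar>D t\<bar> \<le> \<epsilon> / 2" if "\<bar>t\<bar> \<le> 1" for t
      using g(2)[of t] that by (auto simp: D_def gp p_def[symmetric] abs_le_iff)
    have "weight_mean l D = weight_mean l F + (-1) * weight_mean l (poly p)"
      unfolding D_def by (subst weight_mean_add[OF l F]) (auto intro!: continuous_intros simp: weight_mean_cmult[of l "-1", simplified])
    moreover have "mean D = mean F + (-1) * mean (poly p)"
      unfolding D_def by (subst mean_add[OF F]) (auto intro!: continuous_intros simp: mean_cmult[of "-1", simplified])
    moreover have "weight_mean l (poly p) = mean (poly p)"
      by (rule gegenbauer_functional_unique[OF gegenbauer_functional_weight[OF l]]) unfold_locales
    moreover have "\<bar>weight_mean l D\<bar> \<le> \<epsilon> / 2" by (rule weight_mean_bound[OF l D DB])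
    moreover have "\<bar>mean D\<bar> \<le> \<epsilon> / 2"
      unfolding zonal_mean_def by (intro abs_integral_sphere_prob_le[OF sigma_in] DB abs_inner_unit_le norm_e)
    ultimately show ?thesis by linarith
  qed
  then have "\<bar>weight_mean l F - mean F\<bar> \<le> 0" by (rule field_le_epsilon)
  then show ?thesis by simp
qed

lemma gegenbauer_coeff_eq_coef:
  assumes F: "continuous_on UNIV F"
  shows "gegenbauer_coeff F n l = coef F n"
proof -
  have "gegenbauer_coeff F n l = weight_mean l (\<lambda>t. F t * P n t)"
    unfolding gegenbauer_coeff_def weight_mean_def using l
    by (intro arg_cong2[where f = "(*)"] refl set_lebesgue_integral_cong)
      (auto simp: gegenbauer_quotient_eq_geg)
  also have "\<dots> = coef F n"
    unfolding coef_def by (intro weight_mean_eq_mean continuous_intros F)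
  finally show ?thesis .
qed

end

theorem theorem5p13:
  fixes d :: nat and l :: real and F :: "real \<Rightarrow> real"
  assumes "d \<ge> 1"
    and "CARD('n::finite) = d + 1"
    and "l = (real d - 1) / 2"
    and "continuous_on {-1..1} F"
  shows "(\<forall>\<mu> :: (real ^ 'n) measure.
            is_arg_min (energy F) (\<lambda>\<nu>. \<nu> \<in> sphere_prob_measures) \<mu>
              \<longleftrightarrow> \<mu> = normalized_surface_measure)
         \<longleftrightarrow> (\<forall>n\<ge>1. gegenbauer_coeff F n l > 0)"
proof -
  obtain e :: "real ^ 'n" where e: "e \<in> Basis" using nonempty_Basis by blast
  interpret zonal e l
    using assms(1-3) e by unfold_locales simp_all
  \<comment> \<open>Clamping extends F continuously to the whole line without changing it on [-1,1],
    where energies and coefficients are computed.\<close>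
  define G where "G t = F (max (-1) (min 1 t))" for t
  have G: "continuous_on UNIV G"
    unfolding G_def by (rule continuous_on_compose2[OF assms(4)]) (auto intro!: continuous_intros)
  have FG: "F t = G t" if "\<bar>t\<bar> \<le> 1" for t using that by (simp add: G_def abs_le_iff min_absorb2 max_absorb2)
  have energy: "energy F \<mu> = energy G \<mu>" if "\<mu> \<in> sphere_prob_measures" for \<mu> :: "(real ^ 'n) measure"
    by (rule energy_cong[OF that FG])
  have "gegenbauer_coeff F n l = gegenbauer_coeff G n l" for n
    unfolding gegenbauer_coeff_def using FG
    by (intro arg_cong2[where f = "(*)"] refl set_lebesgue_integral_cong) (auto simp: abs_le_iff)
  then have coeff: "gegenbauer_coeff F n l = coef G n" for n
    by (simp add: gegenbauer_coeff_eq_coef[OF G])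
  have \<sigma>: "(\<sigma> :: (real ^ 'n) measure) \<in> sphere_prob_measures" by (rule sigma_in)
  show ?thesis
  proof
    assume min: "\<forall>\<mu> :: (real ^ 'n) measure.
      is_arg_min (energy F) (\<lambda>\<nu>. \<nu> \<in> sphere_prob_measures) \<mu> \<longleftrightarrow> \<mu> = \<sigma>"
    have "energy G (\<sigma> :: (real ^ 'n) measure) < energy G \<mu>"
      if \<mu>: "\<mu> \<in> sphere_prob_measures" "\<mu> \<noteq> \<sigma>" for \<mu> :: "(real ^ 'n) measure"
    proof -
      \<comment> \<open>\<open>\<mu>\<close> is no minimizer, so some \<open>\<nu>\<close> lies
        strictly below it, and \<open>\<sigma>\<close> lies no higher than \<open>\<nu>\<close>;
        this gives the strict inequality.\<close>
      obtain \<nu> :: "(real ^ 'n) measure" where \<nu>: "\<nu> \<in> sphere_prob_measures" "energy F \<nu> < energy F \<mu>"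
        using min \<mu> unfolding is_arg_min_def by blast
      moreover have "\<not> energy F \<nu> < energy F (\<sigma> :: (real ^ 'n) measure)"
        using min \<nu>(1) unfolding is_arg_min_def by blast
      ultimately show ?thesis using energy[OF \<mu>(1)] energy[OF \<sigma>] by linarith
    qed
    then show "\<forall>n\<ge>1. gegenbauer_coeff F n l > 0"
      unfolding coeff by (intro allI impI coef_pos_if_unique_minimizer[OF G])
  next
    assume "\<forall>n\<ge>1. gegenbauer_coeff F n l > 0"
    then have pos: "\<And>n. n \<ge> 1 \<Longrightarrow> coef G n > 0" by (simp add: coeff)
    note min = energy_minimal_at_sigma[OF _ G pos]
    show "\<forall>\<mu> :: (real ^ 'n) measure.
      is_arg_min (energy F) (\<lambda>\<nu>. \<nu> \<in> sphere_prob_measures) \<mu> \<longleftrightarrow> \<mu> = \<sigma>"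
      unfolding is_arg_min_def using min \<sigma> energy by (metis linorder_not_less)
  qed
qed

end
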